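(* Let $k \ge 2$ be an integer. If $k = 2$, let $C$ be the multigraph consisting of two vertices $v_0, v_1$ joined by two parallel edges; if $k \ge 3$, let $C$ be the cycle $v_0 v_1 \ldots v_{k-1} v_0$. For each $i \in \{0, \ldots, k-1\}$ let $H_i$ be a HIST-critical $\{x_i, y_i\}$-fragment, where the graphs $H_0, \ldots, H_{k-1}$ are pairwise disjoint and disjoint from $C$. For every $i$ (indices mod $k$), identify $v_i$ with $x_i$ and $v_{i+1}$ with $y_i$, and remove (one copy of) the edge $v_i v_{i+1}$; thus all edges of $C$ are removed and the resulting graph $G$ is obtained from the disjoint union of $H_0, \ldots, H_{k-1}$ by identifying $y_i$ with $x_{i+1}$ for every $i$ (indices mod $k$). Then $G$ is HIST-critical.
   Context: A HIST of a graph is a spanning tree with no vertex of degree $2$. A graph is HIST-free if it contains no HIST, and HIST-critical if it is HIST-free and $G - v$ contains a HIST for every vertex $v$. For a tree or forest $\Upsilon$, $d_\Upsilon(v)$ denotes the degree of $v$ in $\Upsilon$. Let $F$ be a graph with vertex set $\{x, y, v_1, \ldots, v_\ell\}$, $\ell \ge 1$, $x \ne y$. For a subgraph $H$ of $F$, a spanning tree (resp. spanning forest) $\Upsilon$ of $H$ is an $\{x,y\}$-excluded HIST (resp. $\{x,y\}$-excluded HISF) of $H$ if $d_\Upsilon(v) \ne 2$ for all $v \in V(H) \setminus \{x,y\}$. $F$ is a HIST-critical $\{x,y\}$-fragment if all of the following hold: (1) $F$ has an $\{x,y\}$-excluded HIST, and every $\{x,y\}$-excluded HIST $T$ of $F$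 satisfies $d_T(x) = d_T(y) = 2$; (2) $F - x$ has an $\{x,y\}$-excluded HIST $T$ with $d_T(y) \ne 1$, and $F - y$ has an $\{x,y\}$-excluded HIST $T$ with $d_T(x) \ne 1$; (3) for every $v \in V(F) \setminus \{x,y\}$, the graph $F - v$ has either (a) an $\{x,y\}$-excluded HIST $T$ with $d_T(x) \ne 2$ or $d_T(y) \ne 2$, or (b) an $\{x,y\}$-excluded HISF consisting of exactly two components $T_x$ and $T_y$, each with at least two vertices, such that $x \in V(T_x)$ and $y \in V(T_y)$; (4) $F$ itself has no $\{x,y\}$-excluded HISF consisting of exactly two components $T_x, T_y$, each with at least two vertices, with $x \in V(T_x)$ and $y \in V(T_y)$. *)

theory Defs
  imports Main
begin

record 'a graph =
  verts :: "'a set"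
  edges :: "'a set set"

definition simple_graph :: "'a graph \<Rightarrow> bool" where
  "simple_graph G \<longleftrightarrow> finite (verts G) \<and>
     (\<forall>e \<in> edges G. \<exists>u \<in> verts G. \<exists>v \<in> verts G. u \<noteq> v \<and> e = {u, v})"

definition degree :: "'a graph \<Rightarrow> 'a \<Rightarrow> nat" where
  "degree G v = card {e \<in> edges G. v \<in> e}"

definition subgraph :: "'a graph \<Rightarrow> 'a graph \<Rightarrow> bool" where
  "subgraph H G \<longleftrightarrow> simple_graph H \<and> verts H \<subseteq> verts G \<and> edges H \<subseteq> edges G"

definition induced :: "'a graph \<Rightarrow> 'a set \<Rightarrow> 'a graph" where
  "induced G S = \<lparr>verts = verts G \<inter> S, edges = {e \<in> edges G. e \<subseteq> S}\<rparr>"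

definition delete_vertex :: "'a graph \<Rightarrow> 'a \<Rightarrow> 'a graph" where
  "delete_vertex G v = induced G (verts G - {v})"

definition adj :: "'a graph \<Rightarrow> ('a \<times> 'a) set" where
  "adj G = {(u, v). {u, v} \<in> edges G}"

definition connected_graph :: "'a graph \<Rightarrow> bool" where
  "connected_graph G \<longleftrightarrow> verts G \<noteq> {} \<and> (\<forall>u \<in> verts G. \<forall>v \<in> verts G. (u, v) \<in> (adj G)\<^sup>*)"

definition components :: "'a graph \<Rightarrow> 'a graph set" where
  "components G = (\<lambda>u. induced G {v. (u, v) \<in> (adj G)\<^sup>*}) ` verts G"

text \<open>A cycle is given by the list of its vertices in cyclic order.\<close>

definition is_cycle :: "'a graph \<Rightarrow> 'a list \<Rightarrow> bool" where
  "is_cycle G p \<longleftrightarrow> 3 \<le> length p \<and> distinct p \<and>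
     (\<forall>i < length p. {p ! i, p ! (Suc i mod length p)} \<in> edges G)"

definition is_forest :: "'a graph \<Rightarrow> bool" where
  "is_forest G \<longleftrightarrow> simple_graph G \<and> (\<nexists>p. is_cycle G p)"

definition is_tree :: "'a graph \<Rightarrow> bool" where
  "is_tree G \<longleftrightarrow> is_forest G \<and> connected_graph G"

definition spanning_forest :: "'a graph \<Rightarrow> 'a graph \<Rightarrow> bool" where
  "spanning_forest T G \<longleftrightarrow> is_forest T \<and> subgraph T G \<and> verts T = verts G"

definition spanning_tree :: "'a graph \<Rightarrow> 'a graph \<Rightarrow> bool" where
  "spanning_tree T G \<longleftrightarrow> is_tree T \<and> subgraph T G \<and> verts T = verts G"

definition is_HIST :: "'a graph \<Rightarrow> 'a graph \<Rightarrow> bool" where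
  "is_HIST T G \<longleftrightarrow> spanning_tree T G \<and> (\<forall>v \<in> verts G. degree T v \<noteq> 2)"

definition HIST_free :: "'a graph \<Rightarrow> bool" where
  "HIST_free G \<longleftrightarrow> (\<nexists>T. is_HIST T G)"

definition HIST_critical :: "'a graph \<Rightarrow> bool" where
  "HIST_critical G \<longleftrightarrow> simple_graph G \<and> HIST_free G \<and>
     (\<forall>v \<in> verts G. \<exists>T. is_HIST T (delete_vertex G v))"

definition excluded_HIST :: "'a \<Rightarrow> 'a \<Rightarrow> 'a graph \<Rightarrow> 'a graph \<Rightarrow> bool" where
  "excluded_HIST x y T H \<longleftrightarrow> spanning_tree T H \<and> (\<forall>v \<in> verts H - {x, y}. degree T v \<noteq> 2)"

definition excluded_HISF :: "'a \<Rightarrow> 'a \<Rightarrow> 'a graph \<Rightarrow> 'a graph \<Rightarrow> bool" where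
  "excluded_HISF x y T H \<longleftrightarrow> spanning_forest T H \<and> (\<forall>v \<in> verts H - {x, y}. degree T v \<noteq> 2)"

definition has_split_HISF :: "'a \<Rightarrow> 'a \<Rightarrow> 'a graph \<Rightarrow> bool" where
  "has_split_HISF x y H \<longleftrightarrow>
     (\<exists>T Tx Ty. excluded_HISF x y T H \<and> components T = {Tx, Ty} \<and> Tx \<noteq> Ty \<and>
        2 \<le> card (verts Tx) \<and> 2 \<le> card (verts Ty) \<and> x \<in> verts Tx \<and> y \<in> verts Ty)"

definition HIST_critical_fragment :: "'a graph \<Rightarrow> 'a \<Rightarrow> 'a \<Rightarrow> bool" where
  "HIST_critical_fragment F x y \<longleftrightarrow>
     simple_graph F \<and> x \<in> verts F \<and> y \<in> verts F \<and> x \<noteq> y \<and> verts F - {x, y} \<noteq> {} \<and>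
     (\<exists>T. excluded_HIST x y T F) \<and>
     (\<forall>T. excluded_HIST x y T F \<longrightarrow> degree T x = 2 \<and> degree T y = 2) \<and>
     (\<exists>T. excluded_HIST x y T (delete_vertex F x) \<and> degree T y \<noteq> 1) \<and>
     (\<exists>T. excluded_HIST x y T (delete_vertex F y) \<and> degree T x \<noteq> 1) \<and>
     (\<forall>v \<in> verts F - {x, y}.
        (\<exists>T. excluded_HIST x y T (delete_vertex F v) \<and> (degree T x \<noteq> 2 \<or> degree T y \<noteq> 2)) \<or>
        has_split_HISF x y (delete_vertex F v)) \<and>
     \<not> has_split_HISF x y F"

definition graph_Union :: "'i set \<Rightarrow> ('i \<Rightarrow> 'a graph) \<Rightarrow> 'a graph" where
  "graph_Union I H = \<lparr>verts = (\<Union>i \<in> I. verts (H i)), edges = (\<Union>i \<in> I. edges (H i))\<rparr>"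

text \<open>The vertices of \<open>identify r G\<close> are the classes of the equivalence relation
  generated by \<open>r\<close>.\<close>

definition identify :: "('a \<times> 'a) set \<Rightarrow> 'a graph \<Rightarrow> 'a set graph" where
  "identify r G = (let cls = (\<lambda>u. {w. (u, w) \<in> (r \<union> r\<inverse>)\<^sup>*}) in
     \<lparr>verts = cls ` verts G, edges = (\<lambda>e. cls ` e) ` edges G\<rparr>)"

text \<open>Edge sets cannot record parallel edges. Gluing fragments creates none: if
  \<open>{x, y}\<close> were an edge of a fragment \<open>F\<close>, adding it to an excluded HIST of
  \<open>F - x\<close> would give an excluded HIST of \<open>F\<close> in which \<open>x\<close> has degree 1. So two fragments
  sharing both terminals (the case \<open>k = 2\<close>) have no common edge.\<close>

definition fragment_ring ::
    "nat \<Rightarrow> (nat \<Rightarrow> 'a graph) \<Rightarrow> (nat \<Rightarrow> 'a) \<Rightarrow> (nat \<Rightarrow> 'a) \<Rightarrow> 'a set graph" where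
  "fragment_ring k H x y =
     identify {(y i, x (Suc i mod k)) |i. i < k} (graph_Union {..<k} H)"

end

(* A forest satisfies card V = card E + number of components, and a connected graph with
   card V = card E + 1 is a tree, so gluing can be controlled by counting alone. The restrictions
   T_i of a HIST T of the ring G to the fragments are forests in which every vertex is joined to a
   terminal, so they have at most two components; since card V(G) + k is the sum of the card V(H_i),
   exactly one of them, T_j, has two. The others have degree 2 at both terminals by (1), and by (4)
   a component of T_j is a single terminal, which then has degree 0 + 2 in T. Conversely, deleting a
   vertex leaves a HIST obtained by gluing excluded HISTs of the fragments, one of which is replaced
   by the tree or forest of (3) and whose neighbour, if necessary, by a tree of (2). *)
theory Submission
  imports Defs
begin

section \<open>Forests and components\<close>

text \<open>Spanning trees of all \<open>k\<close> fragments have \<open>card V(G)\<close> edges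
  together, while a tree on \<open>G\<close> has one edge fewer and a tree on \<open>G - w\<close>
  two fewer. A HIST of \<open>G\<close> therefore opens the ring at exactly one fragment. After the
  deletion of a vertex, one missing edge pays for the vertex and one for opening the ring: a split
  forest of (3b) pays both; a tree of (3a) pays one and leaves the other to a neighbour that gives
  up the shared terminal; a deleted terminal charges one edge to each of its two fragments. The
  degrees at the glued terminals explain the constants in the conditions. An unmodified fragment
  contributes 2 at each end, so 0 is the only bad value on the other side, and (4) forces it in a
  HIST of \<open>G\<close>. In \<open>G - w\<close> a neighbour of the fragment containing
  \<open>w\<close> may contribute 0, and then (3a) supplies a degree other than 2. The value 1 is
  excluded in (2) because it could meet another 1.\<close>

abbreviation reach :: "'a graph \<Rightarrow> ('a \<times> 'a) set" where
  "reach G \<equiv> (adj G)\<^sup>*"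

lemma simple_graph_edgeD:
  assumes "simple_graph G" "{u, v} \<in> edges G"
  shows "u \<in> verts G" "v \<in> verts G" "u \<noteq> v"
proof -
  obtain a b where "{u, v} = {a, b}" "a \<noteq> b" "a \<in> verts G" "b \<in> verts G"
    using assms by (auto simp: simple_graph_def)
  then show "u \<in> verts G" "v \<in> verts G" "u \<noteq> v" by (auto simp: doubleton_eq_iff)
qed

lemma simple_graph_edgeE:
  assumes "simple_graph G" "e \<in> edges G"
  obtains u v where "e = {u, v}" "u \<noteq> v" "u \<in> verts G" "v \<in> verts G"
  using assms by (auto simp: simple_graph_def)

lemma simple_graph_edge_subset: "simple_graph G \<Longrightarrow> e \<in> edges G \<Longrightarrow> e \<subseteq> verts G"
  by (auto elim: simple_graph_edgeE)

lemma simple_graph_finite: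
  assumes "simple_graph G"
  shows "finite (verts G)" "finite (edges G)"
proof -
  show V: "finite (verts G)" using assms by (simp add: simple_graph_def)
  have "edges G \<subseteq> Pow (verts G)" using simple_graph_edge_subset[OF assms] by auto
  then show "finite (edges G)" using V finite_subset by blast
qed

lemma simple_graph_subset:
  "simple_graph G \<Longrightarrow> verts H = verts G \<Longrightarrow> edges H \<subseteq> edges G \<Longrightarrow> simple_graph H"
  by (auto simp: simple_graph_def)

lemma reach_sym: "(u, v) \<in> reach G \<Longrightarrow> (v, u) \<in> reach G"
proof -
  have "sym (adj G)" by (auto simp: sym_def adj_def insert_commute)
  then show "(u, v) \<in> reach G \<Longrightarrow> (v, u) \<in> reach G" by (meson sym_rtrancl symD)
qed

lemma reach_edge: "{u, v} \<in> edges G \<Longrightarrow> (u, v) \<in> reach G"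
  by (auto simp: adj_def)

lemma reach_mono: "edges G \<subseteq> edges H \<Longrightarrow> reach G \<subseteq> reach H"
  by (intro rtrancl_mono) (auto simp: adj_def)

lemma reach_verts:
  assumes "(u, v) \<in> reach G" "simple_graph G" "u \<in> verts G"
  shows "v \<in> verts G"
  using assms by (induction rule: rtrancl_induct) (auto simp: adj_def dest: simple_graph_edgeD)

lemma reach_trans: "(u, v) \<in> reach G \<Longrightarrow> (v, w) \<in> reach G \<Longrightarrow> (u, w) \<in> reach G"
  by (rule rtrancl_trans)

lemma reach_class_eq_iff: "{w. (u, w) \<in> reach G} = {w. (v, w) \<in> reach G} \<longleftrightarrow> (u, v) \<in> reach G"
proof
  assume "{w. (u, w) \<in> reach G} = {w. (v, w) \<in> reach G}"
  then have "v \<in> {w. (u, w) \<in> reach G}" by simp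
  then show "(u, v) \<in> reach G" by simp
next
  assume "(u, v) \<in> reach G"
  then show "{w. (u, w) \<in> reach G} = {w. (v, w) \<in> reach G}"
    using reach_trans[of u v G] reach_trans[of v u G] reach_sym[of u v G] by blast
qed

text \<open>A reachability class is recovered as the vertex set of the subgraph that it induces, so
  components can be counted as plain sets of vertices.\<close>

lemma card_components:
  assumes "simple_graph G"
  shows "card (components G) = card ((\<lambda>u. {v. (u, v) \<in> reach G}) ` verts G)"
proof -
  let ?C = "(\<lambda>u. {v. (u, v) \<in> reach G}) ` verts G"
  have "C \<subseteq> verts G" if "C \<in> ?C" for C
    using that reach_verts[OF _ assms] by blast
  then have "verts (induced G C) = C" if "C \<in> ?C" for C
    using that by (simp add: induced_def Int_absorb1)
  then have "inj_on (induced G) ?C" by (rule inj_on_inverseI)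
  moreover have "components G = induced G ` ?C" by (auto simp: components_def)
  ultimately show ?thesis by (simp add: card_image)
qed

lemma connected_graph_iff:
  assumes "simple_graph G"
  shows "connected_graph G \<longleftrightarrow> card (components G) = 1"
proof -
  define cls where "cls = (\<lambda>u. {v. (u, v) \<in> reach G})"
  have cls_eq: "cls u = cls v \<longleftrightarrow> (u, v) \<in> reach G" for u v
    unfolding cls_def by (rule reach_class_eq_iff)
  have "connected_graph G \<longleftrightarrow> verts G \<noteq> {} \<and> (\<forall>u \<in> verts G. \<forall>v \<in> verts G. cls u = cls v)"
    by (simp add: connected_graph_def cls_eq)
  also have "\<dots> \<longleftrightarrow> (\<exists>C. cls ` verts G = {C})"
  proof
    assume "verts G \<noteq> {} \<and> (\<forall>u \<in> verts G. \<forall>v \<in> verts G. cls u = cls v)"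
    then obtain u C where "u \<in> verts G" "\<And>v. v \<in> verts G \<Longrightarrow> cls v = C" by blast
    then have "cls ` verts G = {C}" by force
    then show "\<exists>C. cls ` verts G = {C}" ..
  next
    assume "\<exists>C. cls ` verts G = {C}"
    then obtain C where C: "cls ` verts G = {C}" ..
    have "cls v = C" if "v \<in> verts G" for v using imageI[OF that, of cls] unfolding C by simp
    moreover have "verts G \<noteq> {}" using C by (metis image_is_empty insert_not_empty)
    ultimately show "verts G \<noteq> {} \<and> (\<forall>u \<in> verts G. \<forall>v \<in> verts G. cls u = cls v)" by simp
  qed
  also have "\<dots> \<longleftrightarrow> card (components G) = 1"
    unfolding card_components[OF assms] cls_def[symmetric] by (simp add: card_1_singleton_iff)
  finally show ?thesis .
qed

section \<open>Effect of one additional edge on the components\<close>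

lemma reach_insert_edge:
  "reach \<lparr>verts = V, edges = insert {u, v} E\<rparr> =
     (let R = reach \<lparr>verts = V, edges = E\<rparr> in
      R \<union> {(a, b). (a, u) \<in> R \<and> (v, b) \<in> R} \<union> {(a, b). (a, v) \<in> R \<and> (u, b) \<in> R})"
proof -
  have *: "adj \<lparr>verts = V, edges = insert {u, v} E\<rparr> = insert (u, v) (insert (v, u) (adj \<lparr>verts = V, edges = E\<rparr>))"
    by (auto simp: adj_def doubleton_eq_iff)
  define R where "R = reach \<lparr>verts = V, edges = E\<rparr>"
  have "(a, c) \<in> R" if "(a, b) \<in> R" "(b, c) \<in> R" for a b c
    using that unfolding R_def by (rule rtrancl_trans)
  then have tr: "(a, b) \<in> R" if "(a, u) \<in> R \<and> (u, b) \<in> R \<or> (a, v) \<in> R \<and> (v, b) \<in> R" for a b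
    using that by metis
  have rf: "(u, u) \<in> R" "(v, v) \<in> R" by (simp_all add: R_def)
  \<comment> \<open>Inserting both orientations of the edge also produces walks that pass through it
    twice. Transitivity and reflexivity of \<open>R\<close> absorb these, and a single passage in
    either direction remains.\<close>
  have "(a, b) \<in> reach \<lparr>verts = V, edges = insert {u, v} E\<rparr> \<longleftrightarrow>
      (a, b) \<in> R \<or> (a, u) \<in> R \<and> (v, b) \<in> R \<or> (a, v) \<in> R \<and> (u, b) \<in> R" for a b
    unfolding * rtrancl_insert R_def[symmetric] Un_iff mem_Collect_eq prod.case
    using tr[of a b] rf by argo
  then show ?thesis unfolding Let_def R_def[symmetric] by auto
qed

text \<open>The set of pairs \<open>(f a, g a)\<close> is the graph of a bijection between the two
  images.\<close>

lemma card_image_same_kernel: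
  assumes "\<And>a b. a \<in> A \<Longrightarrow> b \<in> A \<Longrightarrow> f a = f b \<longleftrightarrow> g a = g b"
  shows "card (f ` A) = card (g ` A)"
proof -
  let ?P = "(\<lambda>a. (f a, g a)) ` A"
  have "inj_on fst ?P" "inj_on snd ?P" using assms by (auto simp: inj_on_def)
  then have "card (fst ` ?P) = card (snd ` ?P)" by (simp only: card_image)
  then show ?thesis by (simp add: image_image)
qed

text \<open>The map \<open>m\<close> redirects the class of \<open>v\<close> to the class of
  \<open>u\<close>. It has the same kernel as the new classes, and its image lacks exactly one old
  class if \<open>u\<close> and \<open>v\<close> were separated, and none otherwise.\<close>

lemma card_components_insert:
  assumes s: "simple_graph \<lparr>verts = V, edges = insert {u, v} E\<rparr>"
  shows "card (components \<lparr>verts = V, edges = E\<rparr>) =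
    card (components \<lparr>verts = V, edges = insert {u, v} E\<rparr>) +
    (if (u, v) \<in> reach \<lparr>verts = V, edges = E\<rparr> then 0 else 1)"
proof -
  let ?G = "\<lparr>verts = V, edges = E\<rparr>" and ?G' = "\<lparr>verts = V, edges = insert {u, v} E\<rparr>"
  define cls where "cls = (\<lambda>a. {b. (a, b) \<in> reach ?G})"
  define cls' where "cls' = (\<lambda>a. {b. (a, b) \<in> reach ?G'})"
  define m where "m = (\<lambda>a. if cls a = cls v then cls u else cls a)"
  have s': "simple_graph ?G" using s by (auto simp: simple_graph_def)
  have V: "u \<in> V" "v \<in> V" "finite V" using s simple_graph_edgeD[OF s] by (auto simp: simple_graph_def)
  have R: "(a, b) \<in> reach ?G \<longleftrightarrow> cls a = cls b" for a b
    unfolding cls_def by (rule reach_class_eq_iff[symmetric])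
  have "cls' a = cls' b \<longleftrightarrow> (a, b) \<in> reach ?G'" for a b
    unfolding cls'_def by (rule reach_class_eq_iff)
  moreover have "(a, b) \<in> reach ?G' \<longleftrightarrow> m a = m b" for a b
    unfolding reach_insert_edge Let_def Un_iff mem_Collect_eq prod.case R m_def by auto
  ultimately have "card (cls' ` V) = card (m ` V)" by (intro card_image_same_kernel) simp
  moreover have "m ` V = (if cls u = cls v then cls ` V else cls ` V - {cls v})"
  proof (cases "cls u = cls v")
    case True
    then have "m = cls" by (auto simp: m_def fun_eq_iff)
    then show ?thesis using True by simp
  next
    case False
    have "m ` V = cls ` V - {cls v}"
    proof
      show "m ` V \<subseteq> cls ` V - {cls v}" using False V by (auto simp: m_def)
      show "cls ` V - {cls v} \<subseteq> m ` V" by (auto simp: m_def)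
    qed
    then show ?thesis using False by simp
  qed
  moreover have "card (cls ` V) = Suc (card (cls ` V - {cls v}))"
    using V by (intro card.remove) auto
  ultimately have "card (cls ` V) = card (cls' ` V) + (if (u, v) \<in> reach ?G then 0 else 1)"
    by (simp add: R)
  then show ?thesis
    by (simp add: card_components[OF s] card_components[OF s'] cls_def cls'_def)
qed

section \<open>Simple paths, cycles and redundant edges\<close>

lemma rtrancl_distinct_path:
  assumes "(u, v) \<in> r\<^sup>*"
  shows "\<exists>p. p \<noteq> [] \<and> hd p = u \<and> last p = v \<and> distinct p \<and>
    (\<forall>i. Suc i < length p \<longrightarrow> (p ! i, p ! Suc i) \<in> r)"
  using assms
proof (induction rule: rtrancl_induct)
  case base
  show ?case by (rule exI[of _ "[u]"]) auto
next
  case (step v w)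
  then obtain p where p: "p \<noteq> []" "hd p = u" "last p = v" "distinct p"
    "\<And>i. Suc i < length p \<Longrightarrow> (p ! i, p ! Suc i) \<in> r" by blast
  show ?case
  \<comment> \<open>If the walk returns to a vertex of the path, the path is cut back to that vertex
    instead of being extended.\<close>
  proof (cases "w \<in> set p")
    case True
    then obtain j where j: "j < length p" "p ! j = w" by (auto simp: in_set_conv_nth)
    have "last (take (Suc j) p) = w" using j by (simp add: take_Suc_conv_app_nth)
    then show ?thesis using p j by (intro exI[of _ "take (Suc j) p"]) auto
  next
    case False
    have "((p @ [w]) ! i, (p @ [w]) ! Suc i) \<in> r" if "Suc i < length (p @ [w])" for i
    proof (cases "Suc i < length p")
      case True
      then show ?thesis using p by (simp add: nth_append)
    next
      case False
      then have "i = length p - 1" using that by simp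
      then have "p ! i = v" "Suc i = length p" using p by (auto simp: last_conv_nth)
      then show ?thesis using step.hyps by (simp add: nth_append)
    qed
    then show ?thesis using p False by (intro exI[of _ "p @ [w]"]) auto
  qed
qed

text \<open>A simple path from \<open>u\<close> to \<open>v\<close> has at least three vertices,
  since \<open>{u, v}\<close> is not yet an edge; the new edge closes it.\<close>

lemma is_cycle_closing_edge:
  assumes "(u, v) \<in> reach \<lparr>verts = V, edges = E\<rparr>" "u \<noteq> v" "{u, v} \<notin> E"
  shows "\<exists>p. is_cycle \<lparr>verts = V, edges = insert {u, v} E\<rparr> p"
proof -
  obtain p where p: "p \<noteq> []" "hd p = u" "last p = v" "distinct p"
    "\<And>i. Suc i < length p \<Longrightarrow> {p ! i, p ! Suc i} \<in> E"
    using rtrancl_distinct_path[OF assms(1)] by (auto simp: adj_def)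
  have uv: "p ! 0 = u" "p ! (length p - 1) = v" using p by (auto simp: hd_conv_nth last_conv_nth)
  have "length p \<noteq> 0" "length p \<noteq> 1" "length p \<noteq> 2"
    using uv p(5)[of 0] assms p(1) by (auto simp: numeral_2_eq_2)
  then have "3 \<le> length p" by linarith
  moreover have "{p ! i, p ! (Suc i mod length p)} \<in> insert {u, v} E" if "i < length p" for i
  proof (cases "Suc i < length p")
    case True
    then show ?thesis using p(5) by simp
  next
    case False
    then have "i = length p - 1" "Suc i = length p" using that by auto
    then show ?thesis using uv by (simp add: insert_commute)
  qed
  ultimately show ?thesis using p(4) by (intro exI[of _ p]) (auto simp: is_cycle_def)
qed

lemma is_cycle_mono: "is_cycle G p \<Longrightarrow> edges G \<subseteq> edges H \<Longrightarrow> is_cycle H p"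
  by (auto simp: is_cycle_def)

text \<open>The edge dropped is the one that closes the cyclic list; the other edges of the cycle
  still lead from the first to the last vertex.\<close>

lemma is_cycle_edge_redundant:
  assumes "is_cycle G p"
  obtains u v where "{u, v} \<in> edges G" "(u, v) \<in> reach \<lparr>verts = verts G, edges = edges G - {{u, v}}\<rparr>"
proof
  let ?n = "length p"
  let ?u = "p ! 0" and ?v = "p ! (?n - 1)"
  let ?G = "\<lparr>verts = verts G, edges = edges G - {{?u, ?v}}\<rparr>"
  have n: "3 \<le> ?n" and d: "distinct p"
    and e: "\<And>i. i < ?n \<Longrightarrow> {p ! i, p ! (Suc i mod ?n)} \<in> edges G"
    using assms by (auto simp: is_cycle_def)
  have p0: "p \<noteq> []" using n by auto
  have "Suc (?n - 1) = ?n" using n by simp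
  then show "{?u, ?v} \<in> edges G" using e[of "?n - 1"] n by (simp add: insert_commute)
  have "(?u, p ! i) \<in> reach ?G" if "i < ?n" for i
    using that
  proof (induction i)
    case (Suc i)
    \<comment> \<open>Distinctness turns equal edges into equal positions, and two consecutive
      positions are never the first and the last of a list of length at least 3.\<close>
    have "{p ! i, p ! Suc i} \<noteq> {?u, ?v}"
    proof
      assume "{p ! i, p ! Suc i} = {?u, ?v}"
      then have "i = 0 \<and> Suc i = ?n - 1 \<or> i = ?n - 1 \<and> Suc i = 0"
        using d p0 Suc.prems by (auto simp: doubleton_eq_iff nth_eq_iff_index_eq)
      then show False using n by auto
    qed
    then have "(p ! i, p ! Suc i) \<in> adj ?G" using e[of i] Suc.prems by (simp add: adj_def)
    then show ?case using Suc by (meson Suc_lessD rtrancl.rtrancl_into_rtrancl)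
  qed simp
  then show "(?u, ?v) \<in> reach ?G" using n by simp
qed

section \<open>Forests and trees characterised by their number of edges\<close>

lemma card_verts_le:
  assumes "simple_graph G"
  shows "card (verts G) \<le> card (edges G) + card (components G)"
proof -
  have "card V \<le> card E + card (components \<lparr>verts = V, edges = E\<rparr>)"
    if "finite E" "simple_graph \<lparr>verts = V, edges = E\<rparr>" for V :: "'a set" and E
    using that
  proof (induction E rule: finite_induct)
    case empty
    have "adj \<lparr>verts = V, edges = {}\<rparr> = {}" by (simp add: adj_def)
    then have "inj_on (\<lambda>u. {v. (u, v) \<in> reach \<lparr>verts = V, edges = {}\<rparr>}) V"
      by (auto simp: inj_on_def)
    then show ?case using empty by (simp add: card_components card_image)
  next
    case (insert e E)
    then obtain u v where e: "e = {u, v}" by (auto elim: simple_graph_edgeE)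
    have "simple_graph \<lparr>verts = V, edges = E\<rparr>" using insert.prems by (auto simp: simple_graph_def)
    \<comment> \<open>Each edge lowers the number of components by at most one, and by none if it
      lies inside a component; hence only an inequality.\<close>
    then show ?case using insert card_components_insert[of V u v E] by (auto simp: e split: if_splits)
  qed
  from this[of "edges G" "verts G"] show ?thesis
    using assms simple_graph_finite[OF assms] by (cases G) simp
qed

text \<open>In a forest every inserted edge joins two different components, since otherwise it would
  close a cycle. So the bound of \<open>card_verts_le\<close> is attained at each stage.\<close>

lemma is_forest_imp_card:
  assumes "is_forest G"
  shows "card (verts G) = card (edges G) + card (components G)"
proof -
  have "card V = card E + card (components \<lparr>verts = V, edges = E\<rparr>)"
    if "finite E" "is_forest \<lparr>verts = V, edges = E\<rparr>" for V :: "'a set" and E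
    using that
  proof (induction E rule: finite_induct)
    case empty
    have "adj \<lparr>verts = V, edges = {}\<rparr> = {}" by (simp add: adj_def)
    then have "inj_on (\<lambda>u. {v. (u, v) \<in> reach \<lparr>verts = V, edges = {}\<rparr>}) V"
      by (auto simp: inj_on_def)
    then show ?case using empty by (simp add: is_forest_def card_components card_image)
  next
    case (insert e E)
    then have s: "simple_graph \<lparr>verts = V, edges = insert e E\<rparr>"
      and c: "\<And>p. \<not> is_cycle \<lparr>verts = V, edges = insert e E\<rparr> p" by (auto simp: is_forest_def)
    from s obtain u v where e: "e = {u, v}" "u \<noteq> v" by (auto elim: simple_graph_edgeE)
    have "\<not> is_cycle \<lparr>verts = V, edges = E\<rparr> p" for p
      using c[of p] is_cycle_mono[of "\<lparr>verts = V, edges = E\<rparr>" p "\<lparr>verts = V, edges = insert e E\<rparr>"] by auto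
    then have "is_forest \<lparr>verts = V, edges = E\<rparr>"
      using s by (auto simp: is_forest_def simple_graph_def)
    moreover have "(u, v) \<notin> reach \<lparr>verts = V, edges = E\<rparr>"
      using is_cycle_closing_edge[of u v V E] c insert.hyps e by blast
    ultimately show ?case using insert card_components_insert[of V u v E] s by (simp add: e)
  qed
  from this[of "edges G" "verts G"] show ?thesis
    using assms simple_graph_finite[of G] by (cases G) (simp add: is_forest_def)
qed

text \<open>For the converse, an edge of a cycle could be removed without changing the number of
  components, and the smaller graph would violate \<open>card_verts_le\<close>.\<close>

lemma is_forest_iff_card:
  "is_forest G \<longleftrightarrow> simple_graph G \<and> card (verts G) = card (edges G) + card (components G)"
proof
  assume r: "simple_graph G \<and> card (verts G) = card (edges G) + card (components G)"
  have "\<not> is_cycle G p" for p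
  proof
    assume "is_cycle G p"
    then obtain u v where uv: "{u, v} \<in> edges G"
      "(u, v) \<in> reach \<lparr>verts = verts G, edges = edges G - {{u, v}}\<rparr>"
      by (rule is_cycle_edge_redundant)
    let ?G = "\<lparr>verts = verts G, edges = edges G - {{u, v}}\<rparr>"
    have G: "\<lparr>verts = verts G, edges = insert {u, v} (edges G - {{u, v}})\<rparr> = G"
      unfolding insert_Diff[OF uv(1)] by simp
    have "card (components ?G) = card (components G)"
      using card_components_insert[of "verts G" u v "edges G - {{u, v}}"] uv r unfolding G by simp
    moreover have "card (verts G) \<le> card (edges ?G) + card (components ?G)"
      using card_verts_le[of ?G] r by (auto simp: simple_graph_def)
    moreover have "card (edges G) = Suc (card (edges ?G))"
      using card.remove[of "edges G" "{u, v}"] uv simple_graph_finite[of G] r by simp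
    ultimately show False using r by simp
  qed
  then show "is_forest G" using r by (simp add: is_forest_def)
qed (simp add: is_forest_imp_card, simp add: is_forest_def)

lemma is_tree_iff_card:
  "is_tree G \<longleftrightarrow> simple_graph G \<and> connected_graph G \<and> card (verts G) = Suc (card (edges G))"
  unfolding is_tree_def is_forest_iff_card using connected_graph_iff[of G] by auto

section \<open>Fragments\<close>

lemma card_doubleton_ge: "finite A \<Longrightarrow> u \<in> A \<Longrightarrow> v \<in> A \<Longrightarrow> u \<noteq> v \<Longrightarrow> 2 \<le> card A"
  using card_mono[of A "{u, v}"] by simp

lemma degree_eq_0_iff:
  assumes "simple_graph G"
  shows "degree G u = 0 \<longleftrightarrow> (\<nexists>v. {u, v} \<in> edges G)"
proof -
  have "finite {e \<in> edges G. u \<in> e}" using simple_graph_finite[OF assms] by simp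
  moreover have "\<exists>v. {u, v} \<in> edges G" if "e \<in> edges G" "u \<in> e" for e
  proof -
    obtain a b where "e = {a, b}" using assms \<open>e \<in> edges G\<close> by (elim simple_graph_edgeE)
    then have "e = {u, if u = a then b else a}" using \<open>u \<in> e\<close> by auto
    then show ?thesis using \<open>e \<in> edges G\<close> by metis
  qed
  ultimately show ?thesis unfolding degree_def by auto
qed

lemma degree_eq_0_if_notin: "simple_graph G \<Longrightarrow> u \<notin> verts G \<Longrightarrow> degree G u = 0"
  using degree_eq_0_iff[of G u] simple_graph_edgeD(1)[of G u] by auto

lemma reach_imp_degree_pos:
  assumes "simple_graph G" "(u, v) \<in> reach G" "u \<noteq> v"
  shows "0 < degree G u"
proof -
  obtain w where "(u, w) \<in> adj G" using assms(2,3) by (meson converse_rtranclE)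
  then have "\<exists>w. {u, w} \<in> edges G" by (auto simp: adj_def)
  then show ?thesis using degree_eq_0_iff[OF assms(1), of u] by simp
qed

lemma connected_imp_degree_pos:
  assumes "simple_graph G" "connected_graph G" "u \<in> verts G" "v \<in> verts G" "u \<noteq> v"
  shows "0 < degree G u"
  using assms reach_imp_degree_pos[of G u v] by (auto simp: connected_graph_def)

abbreviation component_of :: "'a graph \<Rightarrow> 'a \<Rightarrow> 'a graph" where
  "component_of G u \<equiv> induced G {v. (u, v) \<in> reach G}"

lemma component_of_eq_iff:
  assumes "v \<in> verts G"
  shows "component_of G u = component_of G v \<longleftrightarrow> (u, v) \<in> reach G"
proof
  assume "component_of G u = component_of G v"
  then have "verts (component_of G u) = verts (component_of G v)" by simp
  moreover have "v \<in> verts (component_of G v)" using assms by (simp add: induced_def)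
  ultimately have "v \<in> verts (component_of G u)" by simp
  then show "(u, v) \<in> reach G" by (simp add: induced_def)
next
  assume "(u, v) \<in> reach G"
  then show "component_of G u = component_of G v" using reach_class_eq_iff[of u G v] by simp
qed

lemma component_eq_component_of:
  assumes "C \<in> components G" "u \<in> verts C"
  shows "C = component_of G u" "u \<in> verts G"
proof -
  obtain w where w: "C = component_of G w" using assms by (auto simp: components_def)
  then have "u \<in> verts G \<and> (w, u) \<in> reach G" using assms by (simp add: induced_def)
  then show "C = component_of G u" "u \<in> verts G" using component_of_eq_iff[of u G w] w by auto
qed

text \<open>This turns the requirement of at least two vertices in (3b) and (4) into a positive
  degree of the terminal, which is what enters the degree sums at glued terminals.\<close>

lemma card_component_of_ge_2_iff:
  assumes "simple_graph G" "u \<in> verts G"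
  shows "2 \<le> card (verts (component_of G u)) \<longleftrightarrow> 0 < degree G u"
proof
  assume "2 \<le> card (verts (component_of G u))"
  then have "\<not> verts (component_of G u) \<subseteq> {u}" using card_mono[of "{u}" "verts (component_of G u)"] by auto
  then obtain v where "v \<noteq> u" "(u, v) \<in> reach G" by (auto simp: induced_def)
  then show "0 < degree G u" using reach_imp_degree_pos assms by metis
next
  assume "0 < degree G u"
  then obtain v where v: "{u, v} \<in> edges G" using degree_eq_0_iff[OF assms(1), of u] by auto
  then have "v \<in> verts (component_of G u)" "u \<noteq> v"
    using simple_graph_edgeD[OF assms(1) v] reach_edge[OF v] by (auto simp: induced_def)
  moreover have "u \<in> verts (component_of G u)" using assms by (simp add: induced_def)
  moreover have "finite (verts (component_of G u))"
    using simple_graph_finite[OF assms(1)] by (simp add: induced_def)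
  ultimately show "2 \<le> card (verts (component_of G u))" using card_doubleton_ge by metis
qed

lemma components_eq_pair:
  assumes "x \<in> verts G" "y \<in> verts G"
    and "\<And>u. u \<in> verts G \<Longrightarrow> (u, x) \<in> reach G \<or> (u, y) \<in> reach G"
  shows "components G = {component_of G x, component_of G y}"
proof
  show "{component_of G x, component_of G y} \<subseteq> components G"
    using assms by (auto simp: components_def)
  show "components G \<subseteq> {component_of G x, component_of G y}"
    unfolding components_def using component_of_eq_iff[of _ G] assms by blast
qed

section \<open>Working forms of the fragment conditions\<close>

lemma excluded_HISTD:
  assumes "excluded_HIST x y T H"
  shows "simple_graph T" "subgraph T H" "verts T = verts H" "connected_graph T"
    "card (verts H) = Suc (card (edges T))"
    "\<And>v. v \<in> verts H \<Longrightarrow> v \<noteq> x \<Longrightarrow> v \<noteq> y \<Longrightarrow> degree T v \<noteq> 2"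
    "\<And>u v. u \<in> verts H \<Longrightarrow> v \<in> verts H \<Longrightarrow> (u, v) \<in> reach T"
  using assms by (auto simp: excluded_HIST_def spanning_tree_def is_tree_iff_card connected_graph_def)

text \<open>The gluing sees a split forest only through these traces: the 2 in the edge count is the
  number of components, and positive terminal degrees express that neither component is a single
  vertex.\<close>

lemma split_HISF_E:
  assumes "has_split_HISF x y H"
  obtains T where "subgraph T H" "verts T = verts H" "card (verts H) = card (edges T) + 2"
    "\<And>v. v \<in> verts H \<Longrightarrow> v \<noteq> x \<Longrightarrow> v \<noteq> y \<Longrightarrow> degree T v \<noteq> 2"
    "0 < degree T x" "0 < degree T y"
    "\<And>u. u \<in> verts H \<Longrightarrow> (u, x) \<in> reach T \<or> (u, y) \<in> reach T"
proof -
  obtain T Tx Ty where T: "excluded_HISF x y T H" "components T = {Tx, Ty}" "Tx \<noteq> Ty"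
    "2 \<le> card (verts Tx)" "2 \<le> card (verts Ty)" "x \<in> verts Tx" "y \<in> verts Ty"
    using assms unfolding has_split_HISF_def by blast
  then have sT: "is_forest T" "subgraph T H" "verts T = verts H"
    and deg: "\<And>v. v \<in> verts H \<Longrightarrow> v \<noteq> x \<Longrightarrow> v \<noteq> y \<Longrightarrow> degree T v \<noteq> 2"
    by (auto simp: excluded_HISF_def spanning_forest_def)
  have s: "simple_graph T" using sT by (simp add: is_forest_def)
  have Tx: "Tx = component_of T x" "x \<in> verts T" and Ty: "Ty = component_of T y" "y \<in> verts T"
    using component_eq_component_of[of Tx T x] component_eq_component_of[of Ty T y] T by auto
  have "card (components T) = 2" using T by simp
  then have "card (verts H) = card (edges T) + 2" using is_forest_imp_card[OF sT(1)] sT by simp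
  moreover have "0 < degree T x" "0 < degree T y"
    using card_component_of_ge_2_iff[OF s] T Tx Ty by auto
  moreover have "(u, x) \<in> reach T \<or> (u, y) \<in> reach T" if "u \<in> verts H" for u
  proof -
    have "component_of T u \<in> components T" using that sT by (simp add: components_def)
    then show ?thesis using T(2) Tx Ty component_of_eq_iff[of _ T u] by auto
  qed
  ultimately show ?thesis using that sT deg by blast
qed

text \<open>If both degrees were positive, the components of \<open>x\<close> and \<open>y\<close>
  would be distinct, exhaust the forest and have two vertices each, so that the forest would be one
  forbidden by (4).\<close>

lemma split_forest_degree:
  assumes "\<not> has_split_HISF x y H" "excluded_HISF x y T H" "x \<in> verts H" "y \<in> verts H"
    and "\<And>u. u \<in> verts H \<Longrightarrow> (u, x) \<in> reach T \<or> (u, y) \<in> reach T"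
    and "(x, y) \<notin> reach T"
  shows "degree T x = 0 \<or> degree T y = 0"
proof (rule ccontr)
  assume n: "\<not> ?thesis"
  have sT: "simple_graph T" "verts T = verts H"
    using assms(2) by (auto simp: excluded_HISF_def spanning_forest_def is_forest_def)
  have "components T = {component_of T x, component_of T y}"
    using components_eq_pair assms sT by metis
  moreover have "component_of T x \<noteq> component_of T y"
    using component_of_eq_iff[of y T x] assms sT by simp
  moreover have "2 \<le> card (verts (component_of T x))" "2 \<le> card (verts (component_of T y))"
    using card_component_of_ge_2_iff[OF sT(1)] assms(3,4) sT(2) n by auto
  moreover have "x \<in> verts (component_of T x)" "y \<in> verts (component_of T y)"
    using assms(3,4) sT by (auto simp: induced_def)
  ultimately show False using assms(1,2) unfolding has_split_HISF_def by blast
qed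

lemma fragmentD:
  assumes "HIST_critical_fragment F x y"
  shows "simple_graph F" "x \<in> verts F" "y \<in> verts F" "x \<noteq> y"
    "\<And>T. excluded_HIST x y T F \<Longrightarrow> degree T x = 2"
    "\<And>T. excluded_HIST x y T F \<Longrightarrow> degree T y = 2"
    "\<not> has_split_HISF x y F"
  using assms by (auto simp: HIST_critical_fragment_def)

lemma subgraph_delete_vertex: "subgraph T (delete_vertex H v) \<Longrightarrow> subgraph T H"
  by (auto simp: subgraph_def delete_vertex_def induced_def)

lemma verts_delete_vertex: "verts (delete_vertex H v) = verts H - {v}"
  by (auto simp: delete_vertex_def induced_def)

text \<open>Condition (2) rules out degree 1. Degree 0 is impossible as well, because the tree is
  connected and contains, besides the remaining terminal, an interior vertex of the
  fragment.\<close>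

lemma fragment_deleteE:
  assumes "HIST_critical_fragment F x y"
  obtains T T' where "excluded_HIST x y T (delete_vertex F x)" "2 \<le> degree T y"
    "excluded_HIST x y T' (delete_vertex F y)" "2 \<le> degree T' x"
proof -
  obtain v where v: "v \<in> verts F" "v \<noteq> x" "v \<noteq> y"
    using assms by (auto simp: HIST_critical_fragment_def)
  obtain T where T: "excluded_HIST x y T (delete_vertex F x)" "degree T y \<noteq> 1"
    using assms by (auto simp: HIST_critical_fragment_def)
  obtain T' where T': "excluded_HIST x y T' (delete_vertex F y)" "degree T' x \<noteq> 1"
    using assms by (auto simp: HIST_critical_fragment_def)
  have "0 < degree T y"
    using connected_imp_degree_pos[of T y v] excluded_HISTD[OF T(1)] fragmentD[OF assms] v
    by (simp add: verts_delete_vertex)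
  moreover have "0 < degree T' x"
    using connected_imp_degree_pos[of T' x v] excluded_HISTD[OF T'(1)] fragmentD[OF assms] v
    by (simp add: verts_delete_vertex)
  ultimately have "2 \<le> degree T y" "2 \<le> degree T' x" using T T' by linarith+
  then show ?thesis using T(1) T'(1) that by blast
qed

lemma degree_insert_edge:
  assumes "finite E" "e \<notin> E"
  shows "degree \<lparr>verts = V, edges = insert e E\<rparr> v = degree \<lparr>verts = W, edges = E\<rparr> v + (if v \<in> e then 1 else 0)"
proof -
  have "{e' \<in> insert e E. v \<in> e'} = (if v \<in> e then insert e {e' \<in> E. v \<in> e'} else {e' \<in> E. v \<in> e'})" by auto
  then show ?thesis using assms by (simp add: degree_def)
qed

text \<open>Adding the edge to a tree of (2) changes degrees only at the terminals, so it yields an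
  excluded HIST, but one with \<open>x\<close> as a leaf, contrary to (1). This keeps the images of
  edges distinct when two fragments share both terminals.\<close>

lemma fragment_terminals_not_adjacent:
  assumes F: "HIST_critical_fragment F x y"
  shows "{x, y} \<notin> edges F"
proof
  assume e: "{x, y} \<in> edges F"
  note F' = fragmentD[OF F]
  obtain T where T: "excluded_HIST x y T (delete_vertex F x)" using fragment_deleteE[OF F] by blast
  note T' = excluded_HISTD[OF T]
  have V: "verts F = insert x (verts T)" "x \<notin> verts T" "y \<in> verts T"
    using T'(3) F' by (auto simp: verts_delete_vertex)
  have x: "{u, x} \<notin> edges T" "{x, u} \<notin> edges T" for u
    using simple_graph_edgeD[OF T'(1), of u x] simple_graph_edgeD[OF T'(1), of x u] V by auto
  let ?T = "\<lparr>verts = verts F, edges = insert {x, y} (edges T)\<rparr>"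
  have fin: "finite (edges T)" "finite (verts T)" using simple_graph_finite[OF T'(1)] by simp_all
  have deg: "degree ?T v = degree T v + (if v \<in> {x, y} then 1 else 0)" for v
    using degree_insert_edge[OF fin(1) x(2), of "verts F" y v "verts T"] by (simp add: degree_def)
  have "edges T \<subseteq> edges F" using T'(2) by (auto simp: subgraph_def delete_vertex_def induced_def)
  then have sub: "edges ?T \<subseteq> edges F" using e by simp
  then have s: "simple_graph ?T" using simple_graph_subset[of F ?T] F'(1) by simp
  have "connected_graph ?T"
  proof -
    have m: "reach T \<subseteq> reach ?T" by (rule reach_mono) auto
    have "(u, y) \<in> reach ?T" if "u \<in> verts F" for u
    proof (cases "u = x")
      case True
      then show ?thesis by (simp add: reach_edge)
    next
      case False
      then have "(u, y) \<in> reach T" using T'(7)[of u y] that F' by (simp add: verts_delete_vertex)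
      then show ?thesis using m by blast
    qed
    then show ?thesis using F'(2) reach_sym reach_trans unfolding connected_graph_def
      by (metis empty_iff graph.select_convs(1))
  qed
  moreover have "card (verts F) = Suc (card (edges ?T))"
    using T'(5) T'(3) V fin x by simp
  ultimately have "is_tree ?T" unfolding is_tree_iff_card using s by simp
  moreover have "degree ?T v \<noteq> 2" if "v \<in> verts F - {x, y}" for v
    using T'(6)[of v] that deg[of v] by (auto simp: verts_delete_vertex)
  ultimately have "excluded_HIST x y ?T F"
    using s sub by (simp add: excluded_HIST_def spanning_tree_def subgraph_def)
  then have "degree ?T x = 2" by (rule F'(5))
  moreover have "degree T x = 0" using degree_eq_0_if_notin T'(1) V by metis
  ultimately show False using deg[of x] by simp
qed

section \<open>Gluing fragments along a ring\<close>

text \<open>\<open>identify r\<close> is the special case of the class map of \<open>r\<close>.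
  Allowing an arbitrary map lets the gluing be studied through its fibres alone.\<close>

definition map_graph :: "('a \<Rightarrow> 'b) \<Rightarrow> 'a graph \<Rightarrow> 'b graph" where
  "map_graph f G = \<lparr>verts = f ` verts G, edges = (`) f ` edges G\<rparr>"

lemma reach_map_graph:
  assumes "(u, v) \<in> reach G"
  shows "(f u, f v) \<in> reach (map_graph f G)"
  using assms
proof (induction rule: rtrancl_induct)
  case (step v w)
  then have "{v, w} \<in> edges G" by (simp add: adj_def)
  then have "f ` {v, w} \<in> (`) f ` edges G" by (rule imageI)
  then have "{f v, f w} \<in> edges (map_graph f G)" by (simp add: map_graph_def)
  then have "(f v, f w) \<in> reach (map_graph f G)" by (simp add: reach_edge)
  then show ?case using step.IH reach_trans by metis
qed simp

text \<open>Used to transfer acyclicity back from a tree of the glued graph to its restriction to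
  one fragment.\<close>

lemma is_cycle_inj_image:
  assumes "is_cycle G p" "simple_graph G" "inj_on f (verts G)"
    and "\<And>e. e \<in> edges G \<Longrightarrow> f ` e \<in> edges G'"
  shows "is_cycle G' (map f p)"
proof -
  have p: "3 \<le> length p" "distinct p"
    "\<And>i. i < length p \<Longrightarrow> {p ! i, p ! (Suc i mod length p)} \<in> edges G"
    using assms(1) by (auto simp: is_cycle_def)
  have "p ! i \<in> verts G" if "i < length p" for i
    using simple_graph_edgeD(1)[OF assms(2) p(3)[OF that]] .
  then have "set p \<subseteq> verts G" by (auto simp: in_set_conv_nth)
  then have "distinct (map f p)" using p(2) assms(3) by (simp add: distinct_map inj_on_subset)
  moreover have "{map f p ! i, map f p ! (Suc i mod length p)} \<in> edges G'" if "i < length p" for i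
  proof -
    have "Suc i mod length p < length p" using that by (intro mod_less_divisor) linarith
    then show ?thesis using assms(4)[OF p(3)[OF that]] that by simp
  qed
  ultimately show ?thesis using p(1) by (simp add: is_cycle_def)
qed

lemma add_mod_neq: "0 < d \<Longrightarrow> d < k \<Longrightarrow> (a + d) mod k \<noteq> a mod k" for a d k :: nat
proof
  assume d: "0 < d" "d < k" and "(a + d) mod k = a mod k"
  then have "k dvd (a + d) - a" using mod_eq_dvd_iff_nat[of a "a + d" k] by simp
  then show False using d by (simp add: nat_dvd_not_less)
qed

lemma mod_shift_surj:
  fixes i k s :: nat
  assumes "i < k"
  obtains m where "m < k" "i = (s + m) mod k"
proof -
  \<comment> \<open>The summand \<open>k - s mod k\<close> represents \<open>-s\<close> modulo
    \<open>k\<close> and avoids the truncated difference \<open>i - s\<close>.\<close>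
  let ?m = "(i + (k - s mod k)) mod k"
  have "s mod k < k" using assms by simp
  have "(s + ?m) mod k = (s mod k + (i + (k - s mod k))) mod k" by (simp add: mod_simps)
  also have "s mod k + (i + (k - s mod k)) = i + k" using \<open>s mod k < k\<close> by linarith
  finally have "(s + ?m) mod k = i" using assms by simp
  then show ?thesis using that[of ?m] assms by simp
qed

text \<open>\<open>f\<close> stands for the quotient map: \<open>f_glue\<close> demands the intended
  identifications and \<open>f_eqD\<close> allows no others. Its last two cases are the two orders
  of an identified pair; for \<open>k = 2\<close> both can occur for the same \<open>i\<close> and
  \<open>j\<close>.\<close>

locale fragment_gluing =
  fixes k :: nat and H :: "nat \<Rightarrow> 'a graph" and x y :: "nat \<Rightarrow> 'a" and f :: "'a \<Rightarrow> 'b"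
  assumes k: "2 \<le> k"
    and fragment: "i < k \<Longrightarrow> HIST_critical_fragment (H i) (x i) (y i)"
    and disjoint: "i < k \<Longrightarrow> j < k \<Longrightarrow> i \<noteq> j \<Longrightarrow> verts (H i) \<inter> verts (H j) = {}"
    and f_glue: "i < k \<Longrightarrow> f (y i) = f (x (Suc i mod k))"
    and f_eqD: "i < k \<Longrightarrow> j < k \<Longrightarrow> u \<in> verts (H i) \<Longrightarrow> v \<in> verts (H j) \<Longrightarrow> f u = f v \<Longrightarrow>
      u = v \<or> u = y i \<and> j = Suc i mod k \<and> v = x j \<or> v = y j \<and> i = Suc j mod k \<and> u = x i"
begin

definition glue :: "(nat \<Rightarrow> 'a graph) \<Rightarrow> 'b graph" where
  "glue S = map_graph f (graph_Union {..<k} S)"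

lemma verts_glue: "verts (glue S) = (\<Union>i<k. f ` verts (S i))"
  by (auto simp: glue_def map_graph_def graph_Union_def)

lemma edges_glue: "edges (glue S) = (`) f ` (\<Union>i<k. edges (S i))"
  by (simp add: glue_def map_graph_def graph_Union_def)

lemma reach_glue: "i < k \<Longrightarrow> (u, v) \<in> reach (S i) \<Longrightarrow> (f u, f v) \<in> reach (glue S)"
  unfolding glue_def
  by (rule reach_map_graph) (use reach_mono[of "S i" "graph_Union {..<k} S"] in \<open>auto simp: graph_Union_def\<close>)

lemma next_less: "Suc i mod k < k"
  using k by simp

lemma next_neq: "i < k \<Longrightarrow> Suc i mod k \<noteq> i"
  using add_mod_neq[of 1 k i] k by simp

lemma next_surj:
  assumes "i < k"
  obtains p where "p < k" "i = Suc p mod k" "p \<noteq> i"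
proof -
  obtain m where m: "m < k" "i = (1 + m) mod k" using assms by (rule mod_shift_surj)
  then show ?thesis using that[of m] next_neq[of m] by auto
qed

lemma simple_H: "i < k \<Longrightarrow> simple_graph (H i)"
  and x_in: "i < k \<Longrightarrow> x i \<in> verts (H i)"
  and y_in: "i < k \<Longrightarrow> y i \<in> verts (H i)"
  and xy_neq: "i < k \<Longrightarrow> x i \<noteq> y i"
  using fragmentD[OF fragment] by auto

lemma vert_index_unique: "i < k \<Longrightarrow> j < k \<Longrightarrow> u \<in> verts (H i) \<Longrightarrow> u \<in> verts (H j) \<Longrightarrow> i = j"
  using disjoint by blast

lemma card_H_remove:
  assumes "i < k" "u \<in> verts (H i)"
  shows "card (verts (H i)) = Suc (card (verts (H i) - {u}))"
  by (rule card.remove[OF simple_graph_finite(1)[OF simple_H[OF assms(1)]] assms(2)])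

lemma f_eq_interiorD:
  assumes "i < k" "j < k" "u \<in> verts (H i)" "u \<noteq> x i" "u \<noteq> y i" "v \<in> verts (H j)" "f u = f v"
  shows "v = u" "j = i"
proof -
  show "v = u" using f_eqD[of i j u v] assms by auto
  then show "j = i" using vert_index_unique assms by blast
qed

text \<open>Two vertices of one fragment could be identified only if the fragment were its own
  successor, which \<open>k \<ge> 2\<close> prevents.\<close>

lemma inj_on_f:
  assumes "i < k"
  shows "inj_on f (verts (H i))"
  using f_eqD[OF assms assms] next_neq[OF assms] by (intro inj_onI) auto

lemma edge_index_unique:
  assumes "i < k" "j < k" "e \<in> edges (H i)" "e \<in> edges (H j)"
  shows "i = j"
proof -
  obtain u v where "e = {u, v}" using assms(1,3) simple_H by (meson simple_graph_edgeE)
  then have "u \<in> verts (H i)" "u \<in> verts (H j)"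
    using assms simple_graph_edgeD(1)[OF simple_H] by auto
  then show ?thesis using vert_index_unique assms(1,2) by blast
qed

lemma f_eq_terminalD:
  assumes "i < k" "j < k" "i \<noteq> j" "u \<in> verts (H i)" "v \<in> verts (H j)" "f u = f v"
  shows "u \<in> {x i, y i}"
  using f_eqD[of i j u v] assms vert_index_unique by auto

text \<open>For two fragments (\<open>k = 2\<close>) both ends of an edge may be identified with the ends of an edge
  of the other fragment; this is excluded since terminals are not adjacent.\<close>

lemma inj_on_image_edges: "inj_on ((`) f) (\<Union>i<k. edges (H i))"
proof (rule inj_onI)
  fix e e'
  assume "e \<in> (\<Union>i<k. edges (H i))" "e' \<in> (\<Union>i<k. edges (H i))" and eq: "f ` e = f ` e'"
  then obtain i j where ij: "i < k" "j < k" and e: "e \<in> edges (H i)" "e' \<in> edges (H j)" by blast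
  have sub: "e \<subseteq> verts (H i)" "e' \<subseteq> verts (H j)"
    using simple_graph_edge_subset[OF simple_H] ij e by auto
  show "e = e'"
  proof (cases "i = j")
    case True
    then show ?thesis using inj_on_f[OF ij(1)] sub eq by (simp add: inj_on_image_eq_iff)
  next
    case False
    have "u \<in> {x i, y i}" if u: "u \<in> e" for u
    proof -
      obtain v where "v \<in> e'" "f u = f v" using u eq by (metis imageE imageI)
      then show ?thesis using f_eq_terminalD[OF ij False, of u v] sub u by blast
    qed
    moreover obtain u v where "e = {u, v}" "u \<noteq> v"
      using simple_graph_edgeE[OF simple_H[OF ij(1)] e(1)] by metis
    ultimately have "e = {x i, y i}" by auto
    then show ?thesis using fragment_terminals_not_adjacent[OF fragment[OF ij(1)]] e by simp
  qed
qed

text \<open>Without their \<open>x\<close>-ends the fragments have disjoint images. Nothing is lost,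
  as each \<open>x\<close>-end reappears as the \<open>y\<close>-end of the preceding
  fragment.\<close>

lemma card_verts_glue: "(\<Sum>i<k. card (verts (H i))) = card (verts (glue H)) + k"
proof -
  let ?V = "\<lambda>i. f ` (verts (H i) - {x i})"
  have "f u \<in> (\<Union>i<k. ?V i)" if u: "i < k" "u \<in> verts (H i)" for i u
  proof (cases "u = x i")
    case True
    obtain p where p: "p < k" "i = Suc p mod k" using next_surj[OF u(1)] by metis
    then have "f u = f (y p)" using f_glue[OF p(1)] True by simp
    moreover have "y p \<in> verts (H p) - {x p}" using y_in[OF p(1)] xy_neq[OF p(1)] by auto
    ultimately show ?thesis using p by auto
  qed (use u in auto)
  then have "verts (glue H) = (\<Union>i<k. ?V i)" unfolding verts_glue by blast
  moreover have "?V i \<inter> ?V j = {}" if "i < k" "j < k" "i \<noteq> j" for i j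
  proof -
    have "f u \<noteq> f v" if "u \<in> verts (H i) - {x i}" "v \<in> verts (H j) - {x j}" for u v
      using f_eqD[of i j u v] vert_index_unique[of i j u] that \<open>i < k\<close> \<open>j < k\<close> \<open>i \<noteq> j\<close> by auto
    then show ?thesis by blast
  qed
  moreover have "finite (?V i)" if "i < k" for i using simple_graph_finite[OF simple_H[OF that]] by simp
  ultimately have "card (verts (glue H)) = (\<Sum>i<k. card (?V i))"
    by (simp add: card_UN_disjoint)
  moreover have "card (verts (H i)) = card (?V i) + 1" if i: "i < k" for i
  proof -
    have "card (?V i) = card (verts (H i) - {x i})"
      using inj_on_subset[OF inj_on_f[OF i]] by (intro card_image) auto
    then show ?thesis using card_H_remove[OF i x_in[OF i]] by linarith
  qed
  ultimately show ?thesis by (simp add: sum_Suc)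
qed

end

text \<open>One setting for both directions: \<open>S\<close> is the family of restrictions of a
  given tree of the ring, or a family of trees and forests chosen in the fragments.\<close>

locale glued_subgraphs = fragment_gluing +
  fixes S :: "nat \<Rightarrow> 'a graph"
  assumes sub: "i < k \<Longrightarrow> subgraph (S i) (H i)"
begin

lemma simple_S: "i < k \<Longrightarrow> simple_graph (S i)"
  and verts_S: "i < k \<Longrightarrow> verts (S i) \<subseteq> verts (H i)"
  and edges_S: "i < k \<Longrightarrow> edges (S i) \<subseteq> edges (H i)"
  using sub by (auto simp: subgraph_def)

lemma simple_glue: "simple_graph (glue S)"
proof -
  have "\<exists>u\<in>verts (glue S). \<exists>v\<in>verts (glue S). u \<noteq> v \<and> e = {u, v}" if e: "e \<in> edges (glue S)" for e
  proof -
    from e obtain i e' where i: "i < k" and e': "e' \<in> edges (S i)" "e = f ` e'"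
      by (auto simp: edges_glue)
    then obtain u v where uv: "e' = {u, v}" "u \<noteq> v" "u \<in> verts (S i)" "v \<in> verts (S i)"
      using simple_graph_edgeE[OF simple_S[OF i] e'(1)] by metis
    then have "f u \<noteq> f v" using inj_onD[OF inj_on_f[OF i], of u v] verts_S[OF i] by auto
    moreover have "f u \<in> verts (glue S)" "f v \<in> verts (glue S)" using uv i by (auto simp: verts_glue)
    ultimately show ?thesis using e'(2) uv(1) by auto
  qed
  moreover have "finite (verts (glue S))" using simple_graph_finite(1)[OF simple_S] by (simp add: verts_glue)
  ultimately show ?thesis by (simp add: simple_graph_def)
qed

lemma inj_on_image_edges_S: "inj_on ((`) f) (\<Union>i<k. edges (S i))"
  using edges_S by (intro inj_on_subset[OF inj_on_image_edges]) blast

lemma card_edges_glue: "card (edges (glue S)) = (\<Sum>i<k. card (edges (S i)))"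
proof -
  have "card (edges (glue S)) = card (\<Union>i<k. edges (S i))"
    unfolding edges_glue by (rule card_image[OF inj_on_image_edges_S])
  also have "\<dots> = (\<Sum>i<k. card (edges (S i)))"
  proof (intro card_UN_disjoint ballI impI)
    fix i j assume "i \<in> {..<k}" "j \<in> {..<k}" "i \<noteq> j"
    then show "edges (S i) \<inter> edges (S j) = {}"
      using edge_index_unique[of i j] edges_S[of i] edges_S[of j] by auto
  qed (use simple_graph_finite(2)[OF simple_S] in auto)
  finally show ?thesis .
qed

lemma degree_glue: "degree (glue S) w = card {e \<in> (\<Union>i<k. edges (S i)). w \<in> f ` e}"
proof -
  have "{e \<in> edges (glue S). w \<in> e} = (`) f ` {e \<in> (\<Union>i<k. edges (S i)). w \<in> f ` e}"
    unfolding edges_glue by blast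
  moreover have "inj_on ((`) f) {e \<in> (\<Union>i<k. edges (S i)). w \<in> f ` e}"
    by (rule inj_on_subset[OF inj_on_image_edges_S]) blast
  ultimately show ?thesis by (simp add: degree_def card_image)
qed

lemma degree_glue_interior:
  assumes i: "i < k" and u: "u \<in> verts (H i)" "u \<noteq> x i" "u \<noteq> y i"
  shows "degree (glue S) (f u) = degree (S i) u"
proof -
  have "e \<in> edges (S i) \<and> u \<in> e" if e: "j < k" "e \<in> edges (S j)" "f u \<in> f ` e" for e j
  proof -
    obtain v where v: "v \<in> e" "f u = f v" using e by blast
    moreover have "v \<in> verts (H j)"
      using v simple_graph_edge_subset[OF simple_H[OF e(1)], of e] edges_S[OF e(1)] e(2) by blast
    ultimately have "v = u" "j = i" using f_eq_interiorD[OF i e(1) u] by auto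
    then show ?thesis using e(2) v(1) by blast
  qed
  then have "{e \<in> (\<Union>i<k. edges (S i)). f u \<in> f ` e} = {e \<in> edges (S i). u \<in> e}"
    using i by blast
  then show ?thesis unfolding degree_glue by (simp only: degree_def)
qed

lemma degree_glue_terminal:
  assumes i: "i < k"
  shows "degree (glue S) (f (y i)) = degree (S i) (y i) + degree (S (Suc i mod k)) (x (Suc i mod k))"
proof -
  let ?j = "Suc i mod k"
  let ?A = "{e \<in> edges (S i). y i \<in> e}" and ?B = "{e \<in> edges (S ?j). x ?j \<in> e}"
  have "e \<in> ?A \<union> ?B" if e: "j < k" "e \<in> edges (S j)" "f (y i) \<in> f ` e" for e j
  proof -
    obtain v where v: "v \<in> e" "f (y i) = f v" using e by blast
    have "v \<in> verts (H j)"
      using v simple_graph_edge_subset[OF simple_H[OF e(1)], of e] edges_S[OF e(1)] e(2) by blast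
    \<comment> \<open>The remaining case of \<open>f_eqD\<close> would make \<open>y i\<close> equal
      to \<open>x i\<close>.\<close>
    then have "v = y i \<and> j = i \<or> v = x ?j \<and> j = ?j"
      using f_eqD[OF i e(1) y_in[OF i] _ v(2)] vert_index_unique[OF i e(1) y_in[OF i]] xy_neq[OF i] by auto
    then show ?thesis using e v by auto
  qed
  moreover have "f (y i) \<in> f ` e" if "e \<in> ?B" for e
    using that f_glue[OF i] by auto
  ultimately have "{e \<in> (\<Union>i<k. edges (S i)). f (y i) \<in> f ` e} = ?A \<union> ?B"
    using i next_less[of i] by blast
  moreover have "?A \<inter> ?B = {}"
    using edge_index_unique[OF i next_less[of i]] edges_S[OF i] edges_S[OF next_less[of i]] next_neq[OF i]
    by auto
  moreover have "finite ?A" "finite ?B"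
    using simple_graph_finite(2)[OF simple_S] i next_less by auto
  ultimately show ?thesis unfolding degree_glue by (simp only: degree_def card_Un_disjoint)
qed

text \<open>The glued terminals \<open>z 0, ..., z n\<close> form a chain in which fragment
  \<open>s + m\<close> links \<open>z m\<close> to \<open>z (m + 1)\<close>, and every other vertex
  hangs on some \<open>z m\<close>. The length \<open>n\<close> is left open because the ring is cut
  in two ways.\<close>

lemma connected_glue_chain:
  assumes tie: "\<And>m. m < n \<Longrightarrow> (x ((s + m) mod k), y ((s + m) mod k)) \<in> reach (S ((s + m) mod k))"
    and cover: "\<And>i u. i < k \<Longrightarrow> u \<in> verts (S i) \<Longrightarrow>
      (\<exists>m\<le>n. i = (s + m) mod k \<and> (u, x i) \<in> reach (S i)) \<or>
      (\<exists>m\<le>n. Suc i mod k = (s + m) mod k \<and> (u, y i) \<in> reach (S i))"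
    and nonempty: "verts (glue S) \<noteq> {}"
  shows "connected_graph (glue S)"
proof -
  define z where "z m = f (x ((s + m) mod k))" for m
  have z: "(z m, z 0) \<in> reach (glue S)" if "m \<le> n" for m
    using that
  proof (induction m)
    case (Suc m)
    let ?i = "(s + m) mod k"
    have i: "?i < k" using k by simp
    have "(f (x ?i), f (y ?i)) \<in> reach (glue S)"
      using reach_glue[OF i] tie[of m] Suc.prems by (simp only: Suc_le_eq)
    moreover have "f (y ?i) = z (Suc m)" using f_glue[OF i] by (simp add: z_def mod_Suc_eq)
    ultimately have "(z (Suc m), z m) \<in> reach (glue S)" using reach_sym by (auto simp: z_def)
    then show ?case using Suc reach_trans by (metis Suc_leD)
  qed simp
  have "(w, z 0) \<in> reach (glue S)" if w: "w \<in> verts (glue S)" for w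
  proof -
    obtain i u where i: "i < k" "u \<in> verts (S i)" "w = f u" using w by (auto simp: verts_glue)
    have "\<exists>m\<le>n. (f u, z m) \<in> reach (glue S)"
      using cover[OF i(1,2)] reach_glue[OF i(1)] f_glue[OF i(1)] unfolding z_def by metis
    then show ?thesis using z reach_trans i(3) by metis
  qed
  then show ?thesis using nonempty reach_sym reach_trans unfolding connected_graph_def by metis
qed

text \<open>Starting just behind the broken fragment, the other \<open>k - 1\<close> fragments link
  all \<open>k\<close> glued terminals, so a vertex may hang on either end of its fragment.\<close>

lemma connected_glue_break:
  assumes "b < k" and "\<And>i. i < k \<Longrightarrow> i \<noteq> b \<Longrightarrow> (x i, y i) \<in> reach (S i)"
    and ends: "\<And>i u. i < k \<Longrightarrow> u \<in> verts (S i) \<Longrightarrow> (u, x i) \<in> reach (S i) \<or> (u, y i) \<in> reach (S i)"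
    and nonempty: "verts (glue S) \<noteq> {}"
  shows "connected_graph (glue S)"
proof (rule connected_glue_chain[where s = "Suc b" and n = "k - 1"])
  fix m assume "m < k - 1"
  then have "(Suc b + m) mod k \<noteq> b" using add_mod_neq[of "Suc m" k b] assms(1) by simp
  then show "(x ((Suc b + m) mod k), y ((Suc b + m) mod k)) \<in> reach (S ((Suc b + m) mod k))"
    using assms(2) k by simp
next
  fix i u assume i: "i < k" "u \<in> verts (S i)"
  have "\<exists>m\<le>k - 1. j = (Suc b + m) mod k" if j: "j < k" for j
    using mod_shift_surj[OF j, of "Suc b"] by (metis Suc_diff_1 less_Suc_eq_le less_nat_zero_code neq0_conv)
  then show "(\<exists>m\<le>k - 1. i = (Suc b + m) mod k \<and> (u, x i) \<in> reach (S i)) \<or>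
      (\<exists>m\<le>k - 1. Suc i mod k = (Suc b + m) mod k \<and> (u, y i) \<in> reach (S i))"
    using ends[OF i] i(1) next_less[of i] by blast
qed (fact nonempty)

text \<open>Without the terminal between \<open>b\<close> and \<open>c\<close>, the other
  \<open>k - 1\<close> glued terminals are linked by the \<open>k - 2\<close> fragments different
  from \<open>b\<close> and \<open>c\<close>. These two hang on the chain at their outer ends:
  \<open>y c\<close> is its start and \<open>x b\<close> its end. For \<open>k = 2\<close> the chain
  is a single vertex.\<close>

lemma connected_glue_missing_terminal:
  assumes b: "b < k" and c: "c = Suc b mod k"
    and "\<And>i u v. i < k \<Longrightarrow> i \<noteq> b \<Longrightarrow> i \<noteq> c \<Longrightarrow> u \<in> verts (H i) \<Longrightarrow> v \<in> verts (H i) \<Longrightarrow> (u, v) \<in> reach (S i)"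
    and Sb: "\<And>u. u \<in> verts (S b) \<Longrightarrow> (u, x b) \<in> reach (S b)"
    and Sc: "\<And>u. u \<in> verts (S c) \<Longrightarrow> (u, y c) \<in> reach (S c)"
    and nonempty: "verts (glue S) \<noteq> {}"
  shows "connected_graph (glue S)"
proof (rule connected_glue_chain[where s = "b + 2" and n = "k - 2"])
  fix m assume "m < k - 2"
  then have "(b + 2 + m) mod k \<noteq> b" "(b + 2 + m) mod k \<noteq> c"
    using add_mod_neq[of "Suc m" k "Suc b"] add_mod_neq[of "m + 2" k b] b c by (simp_all add: add_ac)
  then show "(x ((b + 2 + m) mod k), y ((b + 2 + m) mod k)) \<in> reach (S ((b + 2 + m) mod k))"
    using assms(3) x_in y_in k by simp
next
  fix i u assume i: "i < k" "u \<in> verts (S i)"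
  consider "i = b" | "i = c" | "i \<noteq> b" "i \<noteq> c" by blast
  then show "(\<exists>m\<le>k - 2. i = (b + 2 + m) mod k \<and> (u, x i) \<in> reach (S i)) \<or>
      (\<exists>m\<le>k - 2. Suc i mod k = (b + 2 + m) mod k \<and> (u, y i) \<in> reach (S i))"
  proof cases
    case 1
    have "b + 2 + (k - 2) = b + k" using k by simp
    then have "b = (b + 2 + (k - 2)) mod k" by (simp only: mod_add_self2 mod_less[OF b])
    then show ?thesis using 1 Sb i by blast
  next
    case 2
    have "Suc c mod k = (b + 2 + 0) mod k" using c by (simp add: mod_Suc_eq)
    then show ?thesis using 2 Sc i by blast
  next
    case 3
    obtain m where m: "m < k" "i = (b + 2 + m) mod k" using i(1) by (rule mod_shift_surj)
    \<comment> \<open>Counted from \<open>b + 2\<close>, the offset \<open>k - 2\<close> leads to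
      \<open>b\<close> and the offset \<open>k - 1\<close> to \<open>c\<close>.\<close>
    have "m \<noteq> k - 2"
    proof
      assume "m = k - 2"
      then have eq: "b + 2 + m = b + k" using k by simp
      have "i = b" using m(2) unfolding eq mod_add_self2 mod_less[OF b] .
      then show False using 3(1) by simp
    qed
    moreover have "m \<noteq> k - 1"
    proof
      assume "m = k - 1"
      then have eq: "b + 2 + m = Suc b + k" using k by simp
      have "i = c" using m(2) unfolding eq c mod_add_self2 .
      then show False using 3(2) by simp
    qed
    ultimately have "m \<le> k - 2" using m by linarith
    moreover have "(u, x i) \<in> reach (S i)" using assms(3)[OF i(1) 3] x_in i verts_S by blast
    ultimately show ?thesis using m by blast
  qed
qed (fact nonempty)

text \<open>\<open>c i\<close> is the number of edges by which \<open>S i\<close> falls short of a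
  spanning tree of \<open>H i\<close>. Since \<open>k\<close> spanning trees have
  \<open>card (verts (glue H))\<close> edges together and one vertex is deleted, the total shortfall
  of a tree is 2.\<close>

lemma is_HIST_glue:
  assumes w: "w \<in> verts (glue H)" "verts (glue S) = verts (glue H) - {w}"
    and connected: "connected_graph (glue S)"
    and count: "\<And>i. i < k \<Longrightarrow> card (verts (H i)) = card (edges (S i)) + 1 + c i" "(\<Sum>i<k. c i) = (2::nat)"
    and interior: "\<And>i u. i < k \<Longrightarrow> u \<in> verts (S i) \<Longrightarrow> u \<noteq> x i \<Longrightarrow> u \<noteq> y i \<Longrightarrow> degree (S i) u \<noteq> 2"
    and terminal: "\<And>i. i < k \<Longrightarrow> f (y i) \<noteq> w \<Longrightarrow>
      degree (S i) (y i) + degree (S (Suc i mod k)) (x (Suc i mod k)) \<noteq> 2"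
  shows "is_HIST (glue S) (delete_vertex (glue H) w)"
proof -
  have V: "verts (delete_vertex (glue H) w) = verts (glue S)" using w by (simp add: verts_delete_vertex)
  have "(\<Sum>i<k. card (verts (H i))) = (\<Sum>i<k. card (edges (S i)) + 1 + c i)"
    using count(1) by (intro sum.cong) auto
  also have "\<dots> = card (edges (glue S)) + k + 2" by (simp only: sum.distrib count(2) card_edges_glue) simp
  finally have "card (verts (glue H)) = card (edges (glue S)) + 2" by (simp add: card_verts_glue)
  moreover have "finite (verts (glue H))"
    using simple_graph_finite(1)[OF simple_H] by (simp add: verts_glue)
  ultimately have "card (verts (glue S)) = Suc (card (edges (glue S)))" using w by simp
  then have "is_tree (glue S)" using is_tree_iff_card simple_glue connected by blast
  moreover have "edges (glue S) \<subseteq> edges (delete_vertex (glue H) w)"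
  proof
    fix e assume e: "e \<in> edges (glue S)"
    then have "e \<subseteq> verts (glue H) - {w}" using simple_graph_edge_subset[OF simple_glue] w by blast
    moreover have "e \<in> edges (glue H)" using e edges_S unfolding edges_glue by blast
    ultimately show "e \<in> edges (delete_vertex (glue H) w)" by (simp add: delete_vertex_def induced_def)
  qed
  moreover have "degree (glue S) v \<noteq> 2" if v: "v \<in> verts (glue S)" for v
  proof -
    obtain i u where i: "i < k" and u: "u \<in> verts (S i)" "v = f u" using v by (auto simp: verts_glue)
    have uH: "u \<in> verts (H i)" using verts_S[OF i] u by blast
    have vw: "v \<noteq> w" using v w by blast
    \<comment> \<open>An \<open>x\<close>-end has the same image as the \<open>y\<close>-end of the
      preceding fragment, so it suffices to know the degrees at \<open>y\<close>-ends.\<close>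
    consider "u \<noteq> x i" "u \<noteq> y i" | p where "p < k" "v = f (y p)"
      using next_surj[OF i] f_glue u i by metis
    then show ?thesis
    proof cases
      case 1
      then show ?thesis using degree_glue_interior[OF i uH] interior[OF i u(1)] u by simp
    next
      case 2
      then show ?thesis using degree_glue_terminal terminal vw by simp
    qed
  qed
  ultimately show ?thesis
    using V simple_glue by (simp add: is_HIST_def spanning_tree_def subgraph_def)
qed

end

section \<open>Existence and non-existence of HISTs\<close>

context fragment_gluing
begin

lemma next_inj:
  assumes "i < k" "j < k" "Suc i mod k = Suc j mod k"
  shows "i = j"
  using assms by (auto simp: mod_Suc split: if_splits)

lemma HIST_free_glue: "HIST_free (glue H)"
  unfolding HIST_free_def
proof
  assume "\<exists>T. is_HIST T (glue H)"
  then obtain T where "is_HIST T (glue H)" by blast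
  then have T: "is_tree T" "verts T = verts (glue H)" "edges T \<subseteq> edges (glue H)"
    and deg_T: "\<And>v. v \<in> verts (glue H) \<Longrightarrow> degree T v \<noteq> 2"
    by (auto simp: is_HIST_def spanning_tree_def subgraph_def)
  then have tree_T: "connected_graph T" "card (verts T) = Suc (card (edges T))"
    by (simp_all add: is_tree_iff_card)
  \<comment> \<open>All vertices of \<open>H i\<close> are kept, so that a terminal without edges of
    \<open>T\<close> in this fragment counts as a component.\<close>
  define S where "S i = \<lparr>verts = verts (H i), edges = {e \<in> edges (H i). f ` e \<in> edges T}\<rparr>" for i
  have S_simps: "verts (S i) = verts (H i)" "edges (S i) = {e \<in> edges (H i). f ` e \<in> edges T}" for i
    by (simp_all add: S_def)
  interpret glued_subgraphs k H x y f S
  proof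
    fix i assume "i < k"
    then have "simple_graph (S i)" using simple_graph_subset[of "H i" "S i"] simple_H by (auto simp: S_simps)
    then show "subgraph (S i) (H i)" by (auto simp: subgraph_def S_simps)
  qed
  have verts_glue_S: "verts (glue S) = verts T" by (simp add: T verts_glue S_simps)
  have edges_glue_S: "edges (glue S) = edges T"
  proof
    show "edges (glue S) \<subseteq> edges T" by (auto simp: edges_glue S_simps)
    show "edges T \<subseteq> edges (glue S)"
    proof
      fix e assume e: "e \<in> edges T"
      then obtain i e' where "i < k" "e' \<in> edges (H i)" "e = f ` e'" using T(3) by (auto simp: edges_glue)
      then show "e \<in> edges (glue S)" using e by (auto simp: edges_glue S_simps)
    qed
  qed
  have deg: "degree (glue S) (f u) \<noteq> 2" if "i < k" "u \<in> verts (H i)" for i u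
    using deg_T[of "f u"] that by (auto simp: degree_def edges_glue_S verts_glue)
  have forest: "is_forest (S i)" if i: "i < k" for i
  proof -
    have "\<not> is_cycle T p" for p using T(1) by (simp add: is_tree_def is_forest_def)
    then have "\<not> is_cycle (S i) p" for p
      using is_cycle_inj_image[of "S i" p f T] simple_S[OF i] inj_on_f[OF i] by (auto simp: S_simps)
    then show ?thesis using simple_S[OF i] by (simp add: is_forest_def)
  qed
  have ends: "(u, x i) \<in> reach (S i) \<or> (u, y i) \<in> reach (S i)" if i: "i < k" and u: "u \<in> verts (H i)" for i u
  proof (rule ccontr)
    assume n: "\<not> ?thesis"
    \<comment> \<open>A walk in \<open>T\<close> can leave the image of a fragment only through a
      terminal. If \<open>u\<close> reaches neither terminal inside \<open>S i\<close>, every walk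
      from \<open>f u\<close> lifts to \<open>S i\<close>, including the one that leads to
      \<open>f (x i)\<close>.\<close>
    have "\<exists>u' \<in> verts (H i). w = f u' \<and> (u, u') \<in> reach (S i)" if "(f u, w) \<in> reach T" for w
      using that
    proof (induction rule: rtrancl_induct)
      case base
      then show ?case using u by blast
    next
      case (step v w)
      then obtain u' where u': "u' \<in> verts (H i)" "v = f u'" "(u, u') \<in> reach (S i)" by blast
      have vw: "{v, w} \<in> edges T" using step.hyps by (simp add: adj_def)
      then obtain j e where j: "j < k" and e: "e \<in> edges (S j)" "{v, w} = f ` e"
        unfolding edges_glue_S[symmetric] edges_glue by auto
      have ne: "u' \<noteq> x i" "u' \<noteq> y i" using n u' by auto
      obtain a where a: "a \<in> e" "f u' = f a" using e(2) u'(2) by blast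
      have "e \<subseteq> verts (H j)" using simple_graph_edge_subset[OF simple_H[OF j]] edges_S[OF j] e by blast
      then have "a = u'" "j = i" using f_eq_interiorD[OF i j u'(1) ne, of a] a by auto
      obtain c d where "e = {c, d}" using simple_graph_edgeE[OF simple_S[OF j] e(1)] by metis
      then obtain b where b: "e = {u', b}" using a \<open>a = u'\<close> by auto
      have bi: "{u', b} \<in> edges (S i)" using b e \<open>j = i\<close> by simp
      have "f b = w" using e(2) u'(2) b by (auto simp: doubleton_eq_iff)
      moreover have "b \<in> verts (H i)" using simple_graph_edgeD(2)[OF simple_S[OF i] bi] by (simp add: S_simps)
      moreover have "(u, b) \<in> reach (S i)" using reach_trans[OF u'(3) reach_edge[OF bi]] .
      ultimately show ?case by blast
    qed
    moreover have "(f u, f (x i)) \<in> reach T"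
      using tree_T(1) T(2) i u x_in by (auto simp: connected_graph_def verts_glue)
    ultimately obtain u' where "u' \<in> verts (H i)" "f (x i) = f u'" "(u, u') \<in> reach (S i)" by blast
    then show False using n inj_onD[OF inj_on_f[OF i], of "x i" u'] x_in[OF i] by auto
  qed
  have c: "card (components (S i)) = (if (x i, y i) \<in> reach (S i) then 1 else 2)" if i: "i < k" for i
  proof -
    have "components (S i) = {component_of (S i) (x i), component_of (S i) (y i)}"
      using components_eq_pair[of "x i" "S i" "y i"] ends[OF i] x_in[OF i] y_in[OF i] by (simp add: S_simps)
    then show ?thesis
      using component_of_eq_iff[of "y i" "S i" "x i"] y_in[OF i]
      by (cases "(x i, y i) \<in> reach (S i)") (simp_all add: S_simps(1))
  qed
  have "(\<Sum>i<k. card (verts (H i))) = (\<Sum>i<k. card (edges (S i)) + 1 + (if (x i, y i) \<in> reach (S i) then 0 else 1))"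
  proof (rule sum.cong)
    fix i assume "i \<in> {..<k}"
    then show "card (verts (H i)) = card (edges (S i)) + 1 + (if (x i, y i) \<in> reach (S i) then 0 else 1)"
      using is_forest_imp_card[OF forest, of i] c[of i] by (simp add: S_simps(1))
  qed simp
  also have "\<dots> = card (edges T) + k + (\<Sum>i<k. if (x i, y i) \<in> reach (S i) then 0 else 1)"
    unfolding sum.distrib card_edges_glue[symmetric] edges_glue_S by simp
  \<comment> \<open>With \<open>N\<close> vertices in the ring, both sides of the count are
    \<open>N + k = (N - 1) + k +\<close> the number of fragments in which \<open>T\<close> separates
    the terminals.\<close>
  finally have "(\<Sum>i<k. if (x i, y i) \<in> reach (S i) then 0 else 1) = (1::nat)"
    using card_verts_glue tree_T(2) unfolding T(2) by linarith
  then obtain j where j: "j < k" "(x j, y j) \<notin> reach (S j)"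
    and others: "\<And>i. i < k \<Longrightarrow> i \<noteq> j \<Longrightarrow> (x i, y i) \<in> reach (S i)"
    unfolding sum_eq_1_iff[OF finite_lessThan] by (metis lessThan_iff zero_neq_one)
  have interior: "degree (S i) v \<noteq> 2" if "i < k" "v \<in> verts (H i) - {x i, y i}" for i v
    using degree_glue_interior[of i v] deg[of i v] that by auto
  have degree_2: "degree (S i) (x i) = 2" "degree (S i) (y i) = 2" if i: "i < k" "i \<noteq> j" for i
  proof -
    have "card (components (S i)) = 1" using c[OF i(1)] others[OF i] by simp
    then have "is_tree (S i)" using connected_graph_iff[OF simple_S] forest i by (simp add: is_tree_def)
    then have "excluded_HIST (x i) (y i) (S i) (H i)"
      using interior[OF i(1)] sub[OF i(1)] by (simp add: excluded_HIST_def spanning_tree_def S_simps(1))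
    then show "degree (S i) (x i) = 2" "degree (S i) (y i) = 2"
      using fragmentD(5,6)[OF fragment[OF i(1)]] by auto
  qed
  have "excluded_HISF (x j) (y j) (S j) (H j)"
    using interior[OF j(1)] sub[OF j(1)] forest[OF j(1)]
    by (simp add: excluded_HISF_def spanning_forest_def S_simps(1))
  then have "degree (S j) (x j) = 0 \<or> degree (S j) (y j) = 0"
    by (rule split_forest_degree[OF fragmentD(7)[OF fragment[OF j(1)]] _ x_in[OF j(1)] y_in[OF j(1)] ends[OF j(1)] j(2)])
  then show False
  proof
    assume x0: "degree (S j) (x j) = 0"
    \<comment> \<open>At \<open>x j\<close> the other contribution comes from the preceding
      fragment, at \<open>y j\<close> from the following one; neither is \<open>j\<close>, so it is
      2.\<close>
    obtain p where p: "p < k" "j = Suc p mod k" "p \<noteq> j" using next_surj[OF j(1)] .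
    then have "degree (glue S) (f (y p)) = 2" using degree_glue_terminal[OF p(1)] degree_2(2)[OF p(1,3)] x0 by simp
    then show False using deg[OF p(1) y_in[OF p(1)]] by simp
  next
    assume y0: "degree (S j) (y j) = 0"
    have "degree (glue S) (f (y j)) = 2"
      using degree_glue_terminal[OF j(1)] degree_2(1)[OF next_less next_neq[OF j(1)]] y0 by simp
    then show False using deg[OF j(1) y_in[OF j(1)]] by simp
  qed
qed

section \<open>HISTs of the ring with one vertex deleted\<close>

definition tree :: "nat \<Rightarrow> 'a graph" where
  "tree i = (SOME T. excluded_HIST (x i) (y i) T (H i))"

text \<open>The default filling of a fragment. By (1) it adds 2 at both terminals, so any positive
  contribution from the other side makes the sum at least 3.\<close>

lemma tree:
  assumes "i < k"
  shows "excluded_HIST (x i) (y i) (tree i) (H i)"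
    "degree (tree i) (x i) = 2" "degree (tree i) (y i) = 2"
proof -
  have "\<exists>T. excluded_HIST (x i) (y i) T (H i)"
    using fragment[OF assms] by (simp add: HIST_critical_fragment_def)
  then show T: "excluded_HIST (x i) (y i) (tree i) (H i)" unfolding tree_def by (rule someI_ex)
  show "degree (tree i) (x i) = 2" "degree (tree i) (y i) = 2"
    using fragmentD(5,6)[OF fragment[OF assms] T] .
qed

lemmas treeD = excluded_HISTD[OF tree(1)]

text \<open>The deleted vertex is the \<open>y\<close>-end of \<open>H b\<close> and the
  \<open>x\<close>-end of \<open>H c\<close>, and (2) provides a tree for each of the two
  remainders. At every surviving terminal both sides contribute at least 2.\<close>

lemma HIST_delete_terminal:
  assumes b: "b < k"
  shows "\<exists>T. is_HIST T (delete_vertex (glue H) (f (y b)))"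
proof -
  define c where "c = Suc b mod k"
  have c: "c < k" "c \<noteq> b" using next_less next_neq[OF b] by (auto simp: c_def)
  have fc: "f (x c) = f (y b)" using f_glue[OF b] by (simp add: c_def)
  obtain B where B: "excluded_HIST (x b) (y b) B (delete_vertex (H b) (y b))" "2 \<le> degree B (x b)"
    using fragment_deleteE[OF fragment[OF b]] by metis
  obtain C where C: "excluded_HIST (x c) (y c) C (delete_vertex (H c) (x c))" "2 \<le> degree C (y c)"
    using fragment_deleteE[OF fragment[OF c(1)]] by metis
  note B' = excluded_HISTD[OF B(1), unfolded verts_delete_vertex]
  note C' = excluded_HISTD[OF C(1), unfolded verts_delete_vertex]
  define S where "S = tree(b := B, c := C)"
  have S: "S b = B" "S c = C" "\<And>i. i \<noteq> b \<Longrightarrow> i \<noteq> c \<Longrightarrow> S i = tree i" using c by (auto simp: S_def)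
  have S_cases: "P i (S i)" if "P b B" "P c C" "i \<noteq> b \<Longrightarrow> i \<noteq> c \<Longrightarrow> P i (tree i)" for P i
    using that S by metis
  interpret glued_subgraphs k H x y f S
  proof
    fix i assume "i < k"
    then show "subgraph (S i) (H i)"
      using S_cases[of "\<lambda>i T. subgraph T (H i)"] treeD(2) subgraph_delete_vertex[OF B'(2)] subgraph_delete_vertex[OF C'(2)]
      by blast
  qed
  have V: "verts (S i) = {v \<in> verts (H i). f v \<noteq> f (y b)}" if i: "i < k" for i
  proof -
    \<comment> \<open>The deleted class has the two members \<open>y b\<close> and
      \<open>x c\<close>, so no fragment other than \<open>H b\<close> and \<open>H c\<close> loses
      a vertex.\<close>
    have *: "f v = f (y b) \<longleftrightarrow> v = y b \<and> i = b \<or> v = x c \<and> i = c" if v: "v \<in> verts (H i)" for v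
      using f_eqD[OF i b v y_in[OF b]] fc xy_neq[OF b] vert_index_unique[OF i b v] y_in[OF b] unfolding c_def[symmetric]
      by auto
    consider "i = b" | "i = c" | "i \<noteq> b" "i \<noteq> c" by blast
    then show ?thesis
      by cases (use S B'(3) C'(3) treeD(3)[OF i] c(2) * in auto)
  qed
  have V_glue: "verts (glue S) = verts (glue H) - {f (y b)}"
  proof -
    have "f ` verts (S i) = f ` verts (H i) - {f (y b)}" if "i < k" for i using V[OF that] by auto
    then show ?thesis by (auto simp: verts_glue)
  qed
  have "is_HIST (glue S) (delete_vertex (glue H) (f (y b)))"
  proof (rule is_HIST_glue[where c = "\<lambda>i. (if i = b then 1 else 0) + (if i = c then 1 else 0)"])
    show "f (y b) \<in> verts (glue H)" using b y_in by (auto simp: verts_glue)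
    show "verts (glue S) = verts (glue H) - {f (y b)}" by (rule V_glue)
    show "connected_graph (glue S)"
    proof (rule connected_glue_missing_terminal[OF b c_def])
      show "(u, v) \<in> reach (S i)" if "i < k" "i \<noteq> b" "i \<noteq> c" "u \<in> verts (H i)" "v \<in> verts (H i)" for i u v
        using that S(3) treeD(7) by simp
      show "(u, x b) \<in> reach (S b)" if "u \<in> verts (S b)" for u
        using that S(1) B'(3) B'(7)[of u "x b"] x_in[OF b] xy_neq[OF b] by simp
      show "(u, y c) \<in> reach (S c)" if "u \<in> verts (S c)" for u
        using that S(2) C'(3) C'(7)[of u "y c"] y_in[OF c(1)] xy_neq[OF c(1)] by simp
      have "f (x b) \<noteq> f (y b)" using inj_onD[OF inj_on_f[OF b] _ x_in[OF b] y_in[OF b]] xy_neq[OF b] by blast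
      then have "f (x b) \<in> verts (glue S)" using b x_in V by (auto simp: verts_glue)
      then show "verts (glue S) \<noteq> {}" by blast
    qed
  next
    fix i assume i: "i < k"
    consider "i = b" | "i = c" | "i \<noteq> b" "i \<noteq> c" by blast
    then show "card (verts (H i)) = card (edges (S i)) + 1 + ((if i = b then 1 else 0) + (if i = c then 1 else 0))"
    proof cases
      case 1
      then show ?thesis using B'(5) card_H_remove[OF b y_in[OF b]] S(1) c(2) by simp
    next
      case 2
      then show ?thesis using C'(5) card_H_remove[OF c(1) x_in[OF c(1)]] S(2) c(2) by simp
    next
      case 3
      then show ?thesis using S(3) treeD(5)[OF i] by simp
    qed
  next
    show "(\<Sum>i<k. (if i = b then 1 else 0) + (if i = c then 1 else 0)) = (2::nat)"
      using b c by (simp add: sum.distrib)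
  next
    fix i u assume i: "i < k" and u: "u \<in> verts (S i)" "u \<noteq> x i" "u \<noteq> y i"
    consider "i = b" | "i = c" | "i \<noteq> b" "i \<noteq> c" by blast
    then show "degree (S i) u \<noteq> 2"
      by cases (use S B'(6)[of u] C'(6)[of u] treeD(6)[OF i, of u] u verts_S[OF i] in auto)
  next
    fix i assume i: "i < k" and ne: "f (y i) \<noteq> f (y b)"
    have "i \<noteq> b" using ne by blast
    then have "Suc i mod k \<noteq> c" using next_inj[OF i b] by (auto simp: c_def)
    have "2 \<le> degree (S i) (y i)"
      using \<open>i \<noteq> b\<close> S C(2) tree(3)[OF i] by (cases "i = c") auto
    moreover have "2 \<le> degree (S (Suc i mod k)) (x (Suc i mod k))"
      using \<open>Suc i mod k \<noteq> c\<close> S B(2) tree(2)[OF next_less, of i] by (cases "Suc i mod k = b") auto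
    ultimately show "degree (S i) (y i) + degree (S (Suc i mod k)) (x (Suc i mod k)) \<noteq> 2" by linarith
  qed
  then show ?thesis by blast
qed

text \<open>The last hypothesis permits a neighbouring fragment to give up a terminal, as long as
  \<open>S b\<close> still covers its image.\<close>

lemma verts_glue_delete_interior:
  assumes "b < k" "u \<in> verts (H b)" "u \<noteq> x b" "u \<noteq> y b" "verts (S b) = verts (H b) - {u}"
    and "\<And>i. i < k \<Longrightarrow> verts (S i) \<subseteq> verts (H i)"
    and "\<And>i v. i < k \<Longrightarrow> i \<noteq> b \<Longrightarrow> v \<in> verts (H i) \<Longrightarrow> v \<in> verts (S i) \<or> f v \<in> f ` verts (S b)"
  shows "verts (glue S) = verts (glue H) - {f u}"
proof
  show "verts (glue S) \<subseteq> verts (glue H) - {f u}"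
  proof
    fix w assume "w \<in> verts (glue S)"
    then obtain i v where i: "i < k" "v \<in> verts (S i)" "w = f v" by (auto simp: verts_glue)
    have "v \<in> verts (H i)" using i assms(6) by blast
    moreover have "f v \<noteq> f u"
    proof
      assume "f v = f u"
      then have "v = u" "i = b" using f_eq_interiorD[OF assms(1) i(1) assms(2-4) \<open>v \<in> verts (H i)\<close>] by simp_all
      then show False using i(2) assms(5) by simp
    qed
    ultimately show "w \<in> verts (glue H) - {f u}" using i by (auto simp: verts_glue)
  qed
  show "verts (glue H) - {f u} \<subseteq> verts (glue S)"
  proof
    fix w assume "w \<in> verts (glue H) - {f u}"
    then obtain i v where i: "i < k" "v \<in> verts (H i)" "w = f v" "w \<noteq> f u" by (auto simp: verts_glue)
    have "v \<in> verts (S i) \<or> f v \<in> f ` verts (S b)"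
      using assms(5) assms(7)[OF i(1) _ i(2)] i by (cases "i = b") auto
    then show "w \<in> verts (glue S)" using i(1,3) assms(1) by (auto simp: verts_glue)
  qed
qed

text \<open>Case (3b): the split forest opens the ring inside fragment \<open>b\<close> itself, so
  its shortfall is the full 2 and all other fragments keep their default trees.\<close>

lemma HIST_delete_interior_split:
  assumes b: "b < k" and u: "u \<in> verts (H b)" "u \<noteq> x b" "u \<noteq> y b"
    and "has_split_HISF (x b) (y b) (delete_vertex (H b) u)"
  shows "\<exists>T. is_HIST T (delete_vertex (glue H) (f u))"
proof -
  obtain B where B: "subgraph B (delete_vertex (H b) u)" "verts B = verts (H b) - {u}"
    "card (verts (H b) - {u}) = card (edges B) + 2"
    "\<And>v. v \<in> verts (H b) - {u} \<Longrightarrow> v \<noteq> x b \<Longrightarrow> v \<noteq> y b \<Longrightarrow> degree B v \<noteq> 2"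
    "0 < degree B (x b)" "0 < degree B (y b)"
    "\<And>v. v \<in> verts (H b) - {u} \<Longrightarrow> (v, x b) \<in> reach B \<or> (v, y b) \<in> reach B"
    using split_HISF_E[OF assms(5)] unfolding verts_delete_vertex by metis
  define S where "S = tree(b := B)"
  have S: "S b = B" "\<And>i. i \<noteq> b \<Longrightarrow> S i = tree i" by (auto simp: S_def)
  interpret glued_subgraphs k H x y f S
  proof
    fix i assume "i < k"
    then show "subgraph (S i) (H i)"
      using S treeD(2) subgraph_delete_vertex[OF B(1)] by (cases "i = b") auto
  qed
  have V_glue: "verts (glue S) = verts (glue H) - {f u}"
    by (rule verts_glue_delete_interior[OF b u]) (use S B(2) treeD(3) verts_S in auto)
  have "is_HIST (glue S) (delete_vertex (glue H) (f u))"
  proof (rule is_HIST_glue[where c = "\<lambda>i. if i = b then 2 else 0"])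
    show "f u \<in> verts (glue H)" using b u by (auto simp: verts_glue)
    show "verts (glue S) = verts (glue H) - {f u}" by (rule V_glue)
    show "connected_graph (glue S)"
    proof (rule connected_glue_break[OF b])
      show "(x i, y i) \<in> reach (S i)" if "i < k" "i \<noteq> b" for i
        using that S(2) treeD(7) x_in y_in by simp
      show "(v, x i) \<in> reach (S i) \<or> (v, y i) \<in> reach (S i)" if i: "i < k" and v: "v \<in> verts (S i)" for i v
      proof (cases "i = b")
        case True
        then show ?thesis using v B(2) B(7)[of v] S(1) by simp
      next
        case False
        then show ?thesis using v S(2) treeD(3)[OF i] treeD(7)[OF i, of v "x i"] x_in[OF i] by simp
      qed
      have "f (x b) \<in> verts (glue S)" using b x_in B(2) u S(1) by (auto simp: verts_glue)
      then show "verts (glue S) \<noteq> {}" by blast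
    qed
  next
    fix i assume i: "i < k"
    show "card (verts (H i)) = card (edges (S i)) + 1 + (if i = b then 2 else 0)"
    proof (cases "i = b")
      case True
      then show ?thesis
        using B(3) card_H_remove[OF b u(1)] S(1) by simp
    next
      case False
      then show ?thesis using S(2) treeD(5)[OF i] by simp
    qed
  next
    show "(\<Sum>i<k. if i = b then 2 else 0) = (2::nat)" using b by simp
  next
    fix i v assume i: "i < k" and v: "v \<in> verts (S i)" "v \<noteq> x i" "v \<noteq> y i"
    show "degree (S i) v \<noteq> 2"
      using S B(2) B(4)[of v] treeD(6)[OF i, of v] v verts_S[OF i] by (cases "i = b") auto
  next
    fix i assume i: "i < k"
    \<comment> \<open>At most one of the two fragments meeting in a terminal is \<open>b\<close>;
      the other contributes 2 and \<open>b\<close> a positive amount.\<close>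
    have "degree (S i) (y i) = 2 \<and> 0 < degree (S (Suc i mod k)) (x (Suc i mod k)) \<or>
      0 < degree (S i) (y i) \<and> degree (S (Suc i mod k)) (x (Suc i mod k)) = 2"
      using next_neq[OF i] S B(5,6) tree(3)[OF i] tree(2)[OF next_less, of i]
      by (cases "i = b"; cases "Suc i mod k = b") auto
    then show "degree (S i) (y i) + degree (S (Suc i mod k)) (x (Suc i mod k)) \<noteq> 2" by linarith
  qed
  then show ?thesis by blast
qed

text \<open>Case (3a) with the degree condition at \<open>x b\<close>. The ring is opened in front
  of \<open>b\<close>: the preceding fragment gives up its \<open>y\<close>-end, so the degree at
  the common terminal comes from \<open>B\<close> alone. Elsewhere one side contributes at least 2
  and the other is positive.\<close>

lemma HIST_delete_interior_x:
  assumes b: "b < k" and u: "u \<in> verts (H b)" "u \<noteq> x b" "u \<noteq> y b"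
    and B: "excluded_HIST (x b) (y b) B (delete_vertex (H b) u)" "degree B (x b) \<noteq> 2"
  shows "\<exists>T. is_HIST T (delete_vertex (glue H) (f u))"
proof -
  obtain p where p: "p < k" "b = Suc p mod k" "p \<noteq> b" using next_surj[OF b] .
  obtain C where C: "excluded_HIST (x p) (y p) C (delete_vertex (H p) (y p))" "2 \<le> degree C (x p)"
    using fragment_deleteE[OF fragment[OF p(1)]] by metis
  note B' = excluded_HISTD[OF B(1), unfolded verts_delete_vertex]
  note C' = excluded_HISTD[OF C(1), unfolded verts_delete_vertex]
  have B_pos: "0 < degree B (y b)"
    using connected_imp_degree_pos[of B "y b" "x b"] B'(1,3,4) x_in[OF b] y_in[OF b] xy_neq[OF b] u by auto
  \<comment> \<open>A vertex outside the graph has degree 0, so \<open>degree_glue_terminal\<close>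
    also holds at the terminal that \<open>C\<close> omits.\<close>
  have C_0: "degree C (y p) = 0" using degree_eq_0_if_notin[OF C'(1)] C'(3) by blast
  define S where "S = tree(b := B, p := C)"
  have S: "S b = B" "S p = C" "\<And>i. i \<noteq> b \<Longrightarrow> i \<noteq> p \<Longrightarrow> S i = tree i" using p by (auto simp: S_def)
  interpret glued_subgraphs k H x y f S
  proof
    fix i assume "i < k"
    consider "i = b" | "i = p" | "i \<noteq> b" "i \<noteq> p" by blast
    then show "subgraph (S i) (H i)"
      by cases (use S \<open>i < k\<close> treeD(2) subgraph_delete_vertex[OF B'(2)] subgraph_delete_vertex[OF C'(2)] in auto)
  qed
  have V_glue: "verts (glue S) = verts (glue H) - {f u}"
  proof (rule verts_glue_delete_interior[OF b u])
    show "verts (S b) = verts (H b) - {u}" using S B' by simp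
    show "verts (S i) \<subseteq> verts (H i)" if "i < k" for i by (rule verts_S[OF that])
    show "v \<in> verts (S i) \<or> f v \<in> f ` verts (S b)" if i: "i < k" "i \<noteq> b" and v: "v \<in> verts (H i)" for i v
    proof (cases "i = p")
      case True
      have "f (y p) = f (x b)" using f_glue[OF p(1)] p(2) by simp
      moreover have "x b \<in> verts (S b)" using S B'(3) x_in[OF b] u by simp
      ultimately show ?thesis using True v S(2) C'(3) by (cases "v = y p") auto
    next
      case False
      then show ?thesis using S(3) i v treeD(3) by simp
    qed
  qed
  have "is_HIST (glue S) (delete_vertex (glue H) (f u))"
  proof (rule is_HIST_glue[where c = "\<lambda>i. (if i = b then 1 else 0) + (if i = p then 1 else 0)"])
    show "f u \<in> verts (glue H)" using b u by (auto simp: verts_glue)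
    show "verts (glue S) = verts (glue H) - {f u}" by (rule V_glue)
    show "connected_graph (glue S)"
    proof (rule connected_glue_break[OF p(1)])
      show "(x i, y i) \<in> reach (S i)" if "i < k" "i \<noteq> p" for i
        using that S treeD(7) x_in y_in B'(7)[of "x b" "y b"] u by (cases "i = b") auto
      show "(v, x i) \<in> reach (S i) \<or> (v, y i) \<in> reach (S i)" if i: "i < k" and v: "v \<in> verts (S i)" for i v
      proof -
        consider "i = b" | "i = p" | "i \<noteq> b" "i \<noteq> p" by blast
        then show ?thesis
          by cases (use v S B'(3) C'(3) B'(7)[of v "x b"] C'(7)[of v "x p"] treeD(3)[OF i]
              treeD(7)[OF i, of v "x i"] x_in[OF i] xy_neq[OF i] u in auto)
      qed
      have "f (x b) \<in> verts (glue S)" using b x_in B'(3) u S(1) by (auto simp: verts_glue)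
      then show "verts (glue S) \<noteq> {}" by blast
    qed
  next
    fix i assume i: "i < k"
    consider "i = b" | "i = p" | "i \<noteq> b" "i \<noteq> p" by blast
    then show "card (verts (H i)) = card (edges (S i)) + 1 + ((if i = b then 1 else 0) + (if i = p then 1 else 0))"
    proof cases
      case 1
      then show ?thesis
        using B'(5) card_H_remove[OF b u(1)] S(1) p(3) by simp
    next
      case 2
      then show ?thesis
        using C'(5) card_H_remove[OF i y_in[OF i]] S(2) p(3) by simp
    next
      case 3
      then show ?thesis using S(3) treeD(5)[OF i] by simp
    qed
  next
    show "(\<Sum>i<k. (if i = b then 1 else 0) + (if i = p then 1 else 0)) = (2::nat)"
      using b p by (simp add: sum.distrib)
  next
    fix i v assume i: "i < k" and v: "v \<in> verts (S i)" "v \<noteq> x i" "v \<noteq> y i"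
    consider "i = b" | "i = p" | "i \<noteq> b" "i \<noteq> p" by blast
    then show "degree (S i) v \<noteq> 2"
      by cases (use S B'(3) B'(6)[of v] C'(3) C'(6)[of v] treeD(6)[OF i, of v] v verts_S[OF i] in auto)
  next
    fix i assume i: "i < k"
    show "degree (S i) (y i) + degree (S (Suc i mod k)) (x (Suc i mod k)) \<noteq> 2"
    proof (cases "i = p")
      case True
      then show ?thesis using S(1,2) C_0 B(2) p(2) by simp
    next
      case False
      then have "Suc i mod k \<noteq> b" using next_inj[OF i p(1)] p(2) by auto
      then have "2 \<le> degree (S (Suc i mod k)) (x (Suc i mod k))"
        using S C(2) tree(2)[OF next_less, of i] by (cases "Suc i mod k = p") auto
      moreover have "0 < degree (S i) (y i)"
        using False S B_pos tree(3)[OF i] by (cases "i = b") auto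
      ultimately show ?thesis by linarith
    qed
  qed
  then show ?thesis by blast
qed

text \<open>The mirror image: the ring is opened behind \<open>b\<close>, and the following fragment
  gives up its \<open>x\<close>-end.\<close>

lemma HIST_delete_interior_y:
  assumes b: "b < k" and u: "u \<in> verts (H b)" "u \<noteq> x b" "u \<noteq> y b"
    and B: "excluded_HIST (x b) (y b) B (delete_vertex (H b) u)" "degree B (y b) \<noteq> 2"
  shows "\<exists>T. is_HIST T (delete_vertex (glue H) (f u))"
proof -
  define p where "p = Suc b mod k"
  have p: "p < k" "p \<noteq> b" using next_less next_neq[OF b] by (auto simp: p_def)
  obtain C where C: "excluded_HIST (x p) (y p) C (delete_vertex (H p) (x p))" "2 \<le> degree C (y p)"
    using fragment_deleteE[OF fragment[OF p(1)]] by metis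
  note B' = excluded_HISTD[OF B(1), unfolded verts_delete_vertex]
  note C' = excluded_HISTD[OF C(1), unfolded verts_delete_vertex]
  have B_pos: "0 < degree B (x b)"
    using connected_imp_degree_pos[of B "x b" "y b"] B'(1,3,4) x_in[OF b] y_in[OF b] xy_neq[OF b] u by auto
  have C_0: "degree C (x p) = 0" using degree_eq_0_if_notin[OF C'(1)] C'(3) by blast
  define S where "S = tree(b := B, p := C)"
  have S: "S b = B" "S p = C" "\<And>i. i \<noteq> b \<Longrightarrow> i \<noteq> p \<Longrightarrow> S i = tree i" using p by (auto simp: S_def)
  interpret glued_subgraphs k H x y f S
  proof
    fix i assume "i < k"
    consider "i = b" | "i = p" | "i \<noteq> b" "i \<noteq> p" by blast
    then show "subgraph (S i) (H i)"
      by cases (use S \<open>i < k\<close> treeD(2) subgraph_delete_vertex[OF B'(2)] subgraph_delete_vertex[OF C'(2)] in auto)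
  qed
  have V_glue: "verts (glue S) = verts (glue H) - {f u}"
  proof (rule verts_glue_delete_interior[OF b u])
    show "verts (S b) = verts (H b) - {u}" using S B' by simp
    show "verts (S i) \<subseteq> verts (H i)" if "i < k" for i by (rule verts_S[OF that])
    show "v \<in> verts (S i) \<or> f v \<in> f ` verts (S b)" if i: "i < k" "i \<noteq> b" and v: "v \<in> verts (H i)" for i v
    proof (cases "i = p")
      case True
      have "f (x p) = f (y b)" using f_glue[OF b] by (simp add: p_def)
      moreover have "y b \<in> verts (S b)" using S B'(3) y_in[OF b] u by simp
      ultimately show ?thesis using True v S(2) C'(3) by (cases "v = x p") auto
    next
      case False
      then show ?thesis using S(3) i v treeD(3) by simp
    qed
  qed
  have "is_HIST (glue S) (delete_vertex (glue H) (f u))"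
  proof (rule is_HIST_glue[where c = "\<lambda>i. (if i = b then 1 else 0) + (if i = p then 1 else 0)"])
    show "f u \<in> verts (glue H)" using b u by (auto simp: verts_glue)
    show "verts (glue S) = verts (glue H) - {f u}" by (rule V_glue)
    show "connected_graph (glue S)"
    proof (rule connected_glue_break[OF p(1)])
      show "(x i, y i) \<in> reach (S i)" if "i < k" "i \<noteq> p" for i
        using that S treeD(7) x_in y_in B'(7)[of "x b" "y b"] u by (cases "i = b") auto
      show "(v, x i) \<in> reach (S i) \<or> (v, y i) \<in> reach (S i)" if i: "i < k" and v: "v \<in> verts (S i)" for i v
      proof -
        consider "i = b" | "i = p" | "i \<noteq> b" "i \<noteq> p" by blast
        then show ?thesis
          by cases (use v S B'(3) C'(3) B'(7)[of v "y b"] C'(7)[of v "y p"] treeD(3)[OF i]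
              treeD(7)[OF i, of v "y i"] y_in[OF i] xy_neq[OF i] u in auto)
      qed
      have "f (x b) \<in> verts (glue S)" using b x_in B'(3) u S(1) by (auto simp: verts_glue)
      then show "verts (glue S) \<noteq> {}" by blast
    qed
  next
    fix i assume i: "i < k"
    consider "i = b" | "i = p" | "i \<noteq> b" "i \<noteq> p" by blast
    then show "card (verts (H i)) = card (edges (S i)) + 1 + ((if i = b then 1 else 0) + (if i = p then 1 else 0))"
    proof cases
      case 1
      then show ?thesis
        using B'(5) card_H_remove[OF b u(1)] S(1) p(2) by simp
    next
      case 2
      then show ?thesis
        using C'(5) card_H_remove[OF i x_in[OF i]] S(2) p(2) by simp
    next
      case 3
      then show ?thesis using S(3) treeD(5)[OF i] by simp
    qed
  next
    show "(\<Sum>i<k. (if i = b then 1 else 0) + (if i = p then 1 else 0)) = (2::nat)"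
      using b p by (simp add: sum.distrib)
  next
    fix i v assume i: "i < k" and v: "v \<in> verts (S i)" "v \<noteq> x i" "v \<noteq> y i"
    consider "i = b" | "i = p" | "i \<noteq> b" "i \<noteq> p" by blast
    then show "degree (S i) v \<noteq> 2"
      by cases (use S B'(3) B'(6)[of v] C'(3) C'(6)[of v] treeD(6)[OF i, of v] v verts_S[OF i] in auto)
  next
    fix i assume i: "i < k"
    show "degree (S i) (y i) + degree (S (Suc i mod k)) (x (Suc i mod k)) \<noteq> 2"
    proof (cases "i = b")
      case True
      then show ?thesis using S(1,2) C_0 B(2) by (simp add: p_def)
    next
      case False
      then have "Suc i mod k \<noteq> p" using next_inj[OF i b] by (auto simp: p_def)
      then have "0 < degree (S (Suc i mod k)) (x (Suc i mod k))"
        using S B_pos tree(2)[OF next_less, of i] by (cases "Suc i mod k = b") auto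
      moreover have "2 \<le> degree (S i) (y i)"
        using False S C(2) tree(3)[OF i] by (cases "i = p") auto
      ultimately show ?thesis by linarith
    qed
  qed
  then show ?thesis by blast
qed

lemma HIST_critical_glue: "HIST_critical (glue H)"
proof -
  \<comment> \<open>The fragments themselves are taken as the subgraphs in order to see that the
    ring is a simple graph.\<close>
  interpret H: glued_subgraphs k H x y f H
    by unfold_locales (auto simp: subgraph_def simple_H)
  have "\<exists>T. is_HIST T (delete_vertex (glue H) w)" if w: "w \<in> verts (glue H)" for w
  proof -
    obtain i u where i: "i < k" and u: "u \<in> verts (H i)" "w = f u" using w by (auto simp: verts_glue)
    consider p where "p < k" "w = f (y p)" | "u \<noteq> x i" "u \<noteq> y i"
      using next_surj[OF i] f_glue u i by metis
    then show ?thesis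
    proof cases
      case 1
      then show ?thesis using HIST_delete_terminal by simp
    next
      case 2
      consider T where "excluded_HIST (x i) (y i) T (delete_vertex (H i) u)" "degree T (x i) \<noteq> 2"
        | T where "excluded_HIST (x i) (y i) T (delete_vertex (H i) u)" "degree T (y i) \<noteq> 2"
        | "has_split_HISF (x i) (y i) (delete_vertex (H i) u)"
        using fragment[OF i] u(1) 2 unfolding HIST_critical_fragment_def by blast
      then show ?thesis
        using HIST_delete_interior_x[OF i u(1) 2] HIST_delete_interior_y[OF i u(1) 2]
          HIST_delete_interior_split[OF i u(1) 2] u(2) by cases simp_all
    qed
  qed
  then show ?thesis using H.simple_glue HIST_free_glue by (simp add: HIST_critical_def)
qed

end

section \<open>The ring as a quotient of the disjoint union\<close>

theorem theorem1:
  fixes k :: nat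
    and H :: "nat \<Rightarrow> 'a graph"
    and x y :: "nat \<Rightarrow> 'a"
  assumes "k \<ge> 2"
    and "\<And>i. i < k \<Longrightarrow> HIST_critical_fragment (H i) (x i) (y i)"
    and "\<And>i j. i < k \<Longrightarrow> j < k \<Longrightarrow> i \<noteq> j \<Longrightarrow> verts (H i) \<inter> verts (H j) = {}"
  shows "HIST_critical (fragment_ring k H x y)"
proof -
  define r where "r = {(y i, x (Suc i mod k)) |i. i < k}"
  define cls where "cls = (\<lambda>u. {w. (u, w) \<in> (r \<union> r\<inverse>)\<^sup>*})"
  have r_iff: "(u, v) \<in> r \<longleftrightarrow> (\<exists>i<k. u = y i \<and> v = x (Suc i mod k))" for u v
    by (auto simp: r_def)
  have xy: "x i \<in> verts (H i)" "y i \<in> verts (H i)" "x i \<noteq> y i" if "i < k" for i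
    using fragmentD(2-4)[OF assms(2)[OF that]] by auto
  have uniq: "i = j" if "i < k" "j < k" "u \<in> verts (H i)" "u \<in> verts (H j)" for i j u
    using assms(3)[of i j] that by blast
  have lt: "Suc i mod k < k" for i using assms(1) by simp
  \<comment> \<open>The pairs in \<open>r\<close> form a matching: no vertex is both an
    \<open>x\<close>-end and a \<open>y\<close>-end, and the cyclic successor is injective. Hence
    the generated equivalence adds only reflexive and reversed pairs, and its classes have at most
    two elements.\<close>
  have closed: "u = w \<or> (u, w) \<in> r \<or> (w, u) \<in> r" if "(u, w) \<in> (r \<union> r\<inverse>)\<^sup>*" for u w
    using that
  proof (induction rule: rtrancl_induct)
    case (step v w)
    have "\<not> (v \<in> Domain r \<and> v \<in> Range r)"
      using uniq[OF _ lt] xy(1)[OF lt] xy(2,3) by (auto simp: r_def) metis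
    moreover have "u = w" if "(u, v) \<in> r" "(w, v) \<in> r"
    proof -
      from that(1) obtain i where i: "i < k" "u = y i" "v = x (Suc i mod k)" unfolding r_iff by blast
      from that(2) obtain j where j: "j < k" "w = y j" "v = x (Suc j mod k)" unfolding r_iff by blast
      then have "Suc i mod k = Suc j mod k" using uniq[OF lt lt xy(1)[OF lt]] xy(1)[OF lt] i j by metis
      then show ?thesis using i j by (auto simp: mod_Suc split: if_splits)
    qed
    moreover have "u = w" if "(v, u) \<in> r" "(v, w) \<in> r"
    proof -
      from that(1) obtain i where i: "i < k" "v = y i" "u = x (Suc i mod k)" unfolding r_iff by blast
      from that(2) obtain j where j: "j < k" "v = y j" "w = x (Suc j mod k)" unfolding r_iff by blast
      then have "i = j" using uniq[OF i(1) j(1) xy(2)[OF i(1)]] xy(2)[OF j(1)] i(2) by simp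
      then show ?thesis using i j by simp
    qed
    ultimately show ?case using step by blast
  qed simp
  have cls_eqD: "u = v \<or> (u, v) \<in> r \<or> (v, u) \<in> r" if "cls u = cls v" for u v
  proof -
    have "v \<in> cls v" by (simp add: cls_def)
    then have "(u, v) \<in> (r \<union> r\<inverse>)\<^sup>*" using that by (auto simp: cls_def)
    then show ?thesis by (rule closed)
  qed
  have sym: "sym ((r \<union> r\<inverse>)\<^sup>*)" by (intro sym_rtrancl sym_Un_converse)
  interpret fragment_gluing k H x y cls
  proof
    fix i assume i: "i < k"
    then have "(y i, x (Suc i mod k)) \<in> r" by (auto simp: r_iff)
    then have *: "(y i, x (Suc i mod k)) \<in> (r \<union> r\<inverse>)\<^sup>*" by blast
    have "(y i, w) \<in> (r \<union> r\<inverse>)\<^sup>* \<longleftrightarrow> (x (Suc i mod k), w) \<in> (r \<union> r\<inverse>)\<^sup>*" for w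
      using * symD[OF sym *] rtrancl_trans by metis
    then show "cls (y i) = cls (x (Suc i mod k))" by (simp add: cls_def)
  next
    fix i j u v
    assume "i < k" "j < k" "u \<in> verts (H i)" "v \<in> verts (H j)" "cls u = cls v"
    then show "u = v \<or> u = y i \<and> j = Suc i mod k \<and> v = x j \<or> v = y j \<and> i = Suc j mod k \<and> u = x i"
      using cls_eqD[of u v] uniq xy lt unfolding r_iff by metis
  qed (use assms in auto)
  have "fragment_ring k H x y = glue H"
    unfolding fragment_ring_def identify_def glue_def map_graph_def r_def[symmetric] Let_def cls_def[symmetric] ..
  then show ?thesis using HIST_critical_glue by simp
qed

end
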